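(* Let $\gamma=\{t\in\mathbb{C}:|t+1|=1\}$, let $\sigma\ge1$, and let $\mu$ be a normal majorant of the class $(\sigma,1)$ such that $\mu(0^+)=0$. Let $g:\gamma\to\mathbb{R}$ be the continuous function given by $$g(t)=8\int_0^1\mu(\eta)\,\frac{\big(({\rm Re}\,t)^2-({\rm Im}\,t)^2\big)\big(\eta^4+|t|^4\big)-2\eta^2|t|^4}{\big|\eta^2-t^2\big|^4}\,\eta\,d\eta\qquad\text{for all }t\in\gamma.$$ Then there are positive constants $c$ and $c_1$ not depending on $\varepsilon$ such that, for each choice of the sign $\pm$ and all $\varepsilon\in(0,1/4]$, $$\omega_{\overline{D^{\pm}}}\Big(\big({\rm Re}\,\widetilde{g}\big)^{\pm},\varepsilon\Big)\ge c\,\varepsilon\int_\varepsilon^4\frac{\omega_\gamma(g,\eta)}{\eta^2}\,d\eta\ge c_1\left(M_\gamma(g,\varepsilon)+\varepsilon\int_\varepsilon^4\frac{\omega_\gamma(g,\eta)}{\eta^2}\,d\eta\right).$$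
   Context: A normal majorant of the class $(\sigma,k)$ (with constants $\sigma\ge1$, $k\ge0$) is a non-decreasing real-valued function $\mu(\eta)$ of $\eta>0$ satisfying $\mu(\lambda\eta)\le\sigma\lambda^k\mu(\eta)$ for all $\lambda>1$ and all $\eta>0$. Here $\mu(0^+)$ is the right limit at $0$. The circle $\gamma$ is oriented counterclockwise; $D^+$ is its interior domain and $D^-$ its exterior domain, and the closures $\overline{D^\pm}$ are taken in $\mathbb{C}$. The Cauchy-type integral is $\widetilde g(z):=\frac{1}{2\pi i}\int_\gamma\frac{g(t)}{t-z}\,dt$ for $z\in D^\pm$. It is known that for the circle and any continuous $g:\gamma\to\mathbb{R}$ the function ${\rm Re}\,\widetilde g$ extends continuously from $D^+$ and from $D^-$ to $\gamma$; the continuous extensions of ${\rm Re}\,\widetilde g$ from $D^\pm$ to $\overline{D^\pm}$ are denoted $({\rm Re}\,\widetilde g)^\pm$. For $f:E\to\mathbb{C}$ continuous on $E\subset\mathbb{C}$, the modulus of continuity is $\omega_E(f,\varepsilon):=\sup\{|f(t_1)-f(t_2)|:t_1,t_2\in E,\ |t_1-t_2|\le\varepsilon\}$. For $\xi\in\gamma$ and $\varepsilon>0$ put $\gamma_\varepsilon(\xi):=\{t\in\gamma:|t-\xi|\le\varepsilon\}$, and $$M_{\gamma}(g,\varepsilon):=\sup_{\xi\in\gamma}\,\sup_{\delta\in(0,\varepsilon)}\left|\int_{\gamma_\varepsilon(\xi)\setminus\gamma_\delta(\xi)}\big(g(t)-g(\xi)\big)\,d\arg(t-\xi)\right|,$$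 where $\arg(t-\xi)$ denotes a branch of the argument of $t-\xi$ continuous in $t\in\gamma\setminus\{\xi\}$ and the integral is the Stieltjes integral along $\gamma$, i.e. $d\arg(t-\xi)={\rm Re}\big(\tfrac{1}{i}\tfrac{dt}{t-\xi}\big)$. *)

theory Defs
  imports "HOL-Complex_Analysis.Complex_Analysis"
begin

definition normal_majorant :: "real \<Rightarrow> real \<Rightarrow> (real \<Rightarrow> real) \<Rightarrow> bool" where
  "normal_majorant \<sigma> k \<mu> \<longleftrightarrow>
     \<sigma> \<ge> 1 \<and> k \<ge> 0 \<and> mono_on {0<..} \<mu> \<and>
     (\<forall>l>1. \<forall>\<eta>>0. \<mu> (l * \<eta>) \<le> \<sigma> * l powr k * \<mu> \<eta>)"

definition circ :: "complex set" where
  "circ = {t. cmod (t + 1) = 1}"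

definition dom_plus :: "complex set" where
  "dom_plus = {z. cmod (z + 1) < 1}"

definition dom_minus :: "complex set" where
  "dom_minus = {z. cmod (z + 1) > 1}"

definition cauchy_type_integral :: "(complex \<Rightarrow> real) \<Rightarrow> complex \<Rightarrow> complex" where
  "cauchy_type_integral g z =
     1 / (2 * of_real pi * \<i>) *
       contour_integral (circlepath (-1) 1) (\<lambda>t. of_real (g t) / (t - z))"

definition cont_ext ::
    "complex set \<Rightarrow> (complex \<Rightarrow> 'a::t2_space) \<Rightarrow> complex \<Rightarrow> 'a" where
  "cont_ext D f z = (if z \<in> D then f z else Lim (at z within D) f)"

text \<open>On the closure of \<open>D\<close>, this is the continuous extension of \<open>f\<close> whenever one exists.\<close>

lemma cont_ext_eq:
  assumes "continuous_on (closure D) F" "\<And>z. z \<in> D \<Longrightarrow> F z = f z" "z \<in> closure D"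
  shows "cont_ext D f z = F z"
proof (cases "z \<in> D")
  case False
  then have "z islimpt D"
    using assms(3) by (simp add: closure_def)
  then have nt: "at z within D \<noteq> bot"
    by (simp add: trivial_limit_within)
  have "(F \<longlongrightarrow> F z) (at z within D)"
    using assms(1,3) closure_subset by (auto simp: continuous_on_def intro: tendsto_within_subset)
  then have "(f \<longlongrightarrow> F z) (at z within D)"
    by (rule tendsto_cong[THEN iffD1, rotated]) (auto simp: eventually_at_filter assms(2))
  then show ?thesis
    using nt False by (simp add: cont_ext_def tendsto_Lim)
qed (simp add: cont_ext_def assms(2))

text \<open>Suprema are taken in \<open>[0, \<infinity>]\<close>, so that no boundedness side condition is needed.\<close>

definition mod_cont ::
    "complex set \<Rightarrow> (complex \<Rightarrow> 'a::real_normed_vector) \<Rightarrow> real \<Rightarrow> ennreal" where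
  "mod_cont E f \<epsilon> =
     (SUP (s, t) \<in> {(s, t). s \<in> E \<and> t \<in> E \<and> cmod (s - t) \<le> \<epsilon>}. ennreal (norm (f s - f t)))"

definition circ_arc :: "complex \<Rightarrow> real \<Rightarrow> complex set" where
  "circ_arc \<xi> \<epsilon> = {t \<in> circ. cmod (t - \<xi>) \<le> \<epsilon>}"

text \<open>
  The Stieltjes integral of \<open>h\<close> over \<open>A \<subseteq> circ\<close> with respect to \<open>d arg (t - \<xi>)\<close>,
  written out along the counterclockwise parametrisation \<open>t = circlepath (-1) 1 s\<close> via
  \<open>d arg (t - \<xi>) = Re (dt / (\<i> (t - \<xi>)))\<close>.
\<close>

definition arg_integral :: "complex \<Rightarrow> complex set \<Rightarrow> (complex \<Rightarrow> real) \<Rightarrow> real" where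
  "arg_integral \<xi> A h =
     integral {s \<in> {0..1}. circlepath (-1) 1 s \<in> A}
       (\<lambda>s. h (circlepath (-1) 1 s) *
            Re (1 / \<i> * (vector_derivative (circlepath (-1) 1) (at s) / (circlepath (-1) 1 s - \<xi>))))"

definition M_circ :: "(complex \<Rightarrow> real) \<Rightarrow> real \<Rightarrow> ennreal" where
  "M_circ g \<epsilon> =
     (SUP \<xi> \<in> circ. SUP \<delta> \<in> {0<..<\<epsilon>}.
        ennreal \<bar>arg_integral \<xi> (circ_arc \<xi> \<epsilon> - circ_arc \<xi> \<delta>) (\<lambda>t. g t - g \<xi>)\<bar>)"

end

theory Submission
  imports Defs
begin

text \<open>
  With \<open>k(t) = \<eta> t\<^sup>2 / (\<eta>\<^sup>2 - t\<^sup>2)\<^sup>2\<close> the function \<open>g\<close> equals \<open>8 \<integral> \<mu>(\<eta>) Re k(t) d\<eta>\<close>. On the circle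
  \<open>|\<eta>\<^sup>2 - t\<^sup>2| \<ge> (\<eta>\<^sup>2 + |t|\<^sup>2)/2\<close>, and together with \<open>\<mu>(\<eta>) \<le> \<sigma> (\<eta> + r) \<mu>(r) / r\<close> this makes
  \<open>\<omega>(g, \<delta>) \<le> C \<mu>(\<delta>)\<close>.

  The map \<open>t \<mapsto> -t/(t+1)\<close> is conjugation on the circle and exchanges \<open>D\<^sup>+\<close> with \<open>D\<^sup>-\<close>, so \<open>Re k\<close>
  is on the circle the real part of a function \<open>q\<close> holomorphic on the closed disc. The real part
  of the Cauchy kernel is affine in the Poisson kernel, which gives for real \<open>z = w - 1\<close> the
  value \<open>4 \<integral> \<mu> Re (q(-1) + q(w - 1)) d\<eta>\<close> of \<open>Re g~\<close> inside the circle and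
  \<open>4 \<integral> \<mu> Re (q(-1) - q(1/w - 1)) d\<eta>\<close> outside. On \<open>(-1, 0)\<close> both terms of \<open>q\<close> are negative, and
  so the increment of \<open>Re g~\<close> between \<open>0\<close> and a point at distance comparable to \<open>\<epsilon>\<close> is at
  least \<open>\<integral> \<mu>(\<eta>) x / (\<eta> + x)\<^sup>2 d\<eta>\<close> with \<open>\<epsilon>/2 \<le> x \<le> \<epsilon>\<close>; no cancellation can occur.

  The second inequality holds because \<open>M(g, \<epsilon>) \<le> \<pi> \<omega>(g, \<epsilon>)\<close>.
\<close>

section \<open>The kernel on the circle\<close>

text \<open>On the circle, with \<open>0 \<le> \<eta> \<le> 1\<close>, the denominator vanishes only
  for \<open>\<eta> = 0\<close> and \<open>t = 0\<close>, where division by zero yields the value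
  0.\<close>

definition kern :: "real \<Rightarrow> complex \<Rightarrow> real" where
  "kern \<eta> t = \<eta> * Re (t^2 / ((of_real \<eta>)^2 - t^2)^2)"

text \<open>Expand \<open>w / b^2\<close> by the conjugate of \<open>b^2\<close>, with
  \<open>w = t^2\<close> and \<open>b = \<eta>^2 - w\<close>. When \<open>b = 0\<close> both sides
  are 0.\<close>

lemma kern_formula:
  "(((Re t)^2 - (Im t)^2) * (\<eta>^4 + cmod t^4) - 2 * \<eta>^2 * cmod t^4)
     / cmod (of_real \<eta>^2 - t^2)^4 * \<eta> = kern \<eta> t"
proof -
  define w where "w = t^2"
  have w: "Re w = (Re t)^2 - (Im t)^2"
    by (simp add: w_def power2_eq_square)
  have "cmod t^4 = (cmod w)^2"
    by (simp add: w_def norm_power)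
  then have c: "cmod t^4 = (Re w)^2 + (Im w)^2"
    by (simp add: cmod_power2)
  define b where "b = (of_real \<eta>)^2 - w"
  have b: "Re b = \<eta>^2 - Re w" "Im b = - Im w"
    by (simp_all add: b_def power2_eq_square)
  have "Re (w * cnj (b\<^sup>2)) = Re w * (\<eta>^4 + ((Re w)^2 + (Im w)^2)) - 2 * \<eta>^2 * ((Re w)^2 + (Im w)^2)"
    by (simp add: b power2_eq_square power4_eq_xxxx algebra_simps)
  moreover have "Re (w / b\<^sup>2) = Re (w * cnj (b\<^sup>2)) / cmod b ^ 4"
  proof -
    have "w / b\<^sup>2 = (w * cnj (b\<^sup>2)) / of_real (cmod b ^ 4)"
      by (subst complex_div_cnj) (simp add: norm_power)
    then show ?thesis by (metis Re_divide_of_real)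
  qed
  ultimately show ?thesis
    unfolding kern_def w[symmetric] c w_def[symmetric] b_def[symmetric] by simp
qed

lemma circ_Re: "t \<in> circ \<Longrightarrow> 2 * Re t = - ((cmod t)^2)"
proof -
  assume "t \<in> circ"
  then have "(cmod (t + 1))^2 = 1" by (simp add: circ_def)
  then have "(Re t + 1)^2 + (Im t)^2 = 1" unfolding cmod_power2 by simp
  then show ?thesis unfolding cmod_power2 by (simp add: power2_eq_square algebra_simps)
qed

lemma circ_norm_le: "t \<in> circ \<Longrightarrow> cmod t \<le> 2"
  using norm_triangle_ineq4[of "t + 1" 1] by (simp add: circ_def)

text \<open>On the circle \<open>Re t\<close> is determined by \<open>R = |t|^2\<close>, so the
  squared modulus is a polynomial in \<open>R\<close> and \<open>a = \<eta>^2\<close>, which is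
  compared with \<open>((a + R)/2)^2\<close>.\<close>

lemma denominator_lower_bound:
  assumes t: "t \<in> circ" and \<eta>: "0 \<le> \<eta>" "\<eta> \<le> 1"
  shows "cmod ((of_real \<eta>)^2 - t^2) \<ge> (\<eta>^2 + (cmod t)^2) / 2"
proof -
  define a R where "a = \<eta>^2" and "R = (cmod t)^2"
  have a: "0 \<le> a" "a \<le> 1" using \<eta> by (auto simp: a_def power_le_one)
  have R: "0 \<le> R" "R \<le> 4"
    using circ_norm_le[OF t] power_mono[of "cmod t" 2 2] by (auto simp: R_def)
  have Re: "Re t = - R / 2" using circ_Re[OF t] by (simp add: R_def)
  have Im: "(Im t)^2 = R - R^2/4"
    using cmod_power2[of t] Re by (simp add: R_def[symmetric] power_divide)
  have Rew: "Re (t^2) = R^2/2 - R"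
    using Re Im by (simp add: power2_eq_square)
  have "cmod (t^2) ^ 2 = R^2" by (simp add: R_def norm_power)
  then have n: "(Re (t^2))^2 + (Im (t^2))^2 = R^2" by (simp add: cmod_power2)
  have "(cmod ((of_real \<eta>)^2 - t^2))^2 = (a - Re (t^2))^2 + (Im (t^2))^2"
    by (simp add: cmod_power2 a_def)
  also have "\<dots> = a^2 + R^2 - 2 * a * (R^2/2 - R)"
    using n Rew by (simp add: power2_diff)
  \<comment> \<open>Every term after the first is nonnegative, because \<open>a \<le> 1\<close> and
    \<open>R \<le> 4\<close>.\<close>
  also have "\<dots> = (a^2 + R^2)/2 + a^2/2 + R^2 * (1 - a)/2 + a * R * (4 - R) / 2"
    by (simp add: power2_eq_square field_simps)
  also have "\<dots> \<ge> (a^2 + R^2)/2"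
  proof -
    have "0 \<le> a^2/2" "0 \<le> R^2 * (1 - a)/2" "0 \<le> a * R * (4 - R) / 2" using a R by simp_all
    then show ?thesis by linarith
  qed
  finally have 1: "(cmod ((of_real \<eta>)^2 - t^2))^2 \<ge> (a^2 + R^2)/2" .
  have "((a + R)/2)^2 \<le> (a^2 + R^2)/2"
    using zero_le_power2[of "a - R"] by (simp add: power2_eq_square field_simps)
  with 1 have "((a + R)/2)^2 \<le> (cmod ((of_real \<eta>)^2 - t^2))^2" by linarith
  then show ?thesis unfolding a_def R_def by (rule power2_le_imp_le) simp
qed

lemma sum_squares_ge_half_square: "(a + b)^2 \<le> 2 * (a^2 + b^2)" for a b :: real
  using zero_le_power2[of "a - b"] by (simp add: power2_eq_square algebra_simps)

text \<open>The fourth power in the denominator leaves room to lose one factor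
  \<open>\<eta> + |t|\<close> to the growth of the majorant.\<close>

lemma kern_bound:
  assumes t: "t \<in> circ" and \<eta>: "0 \<le> \<eta>" "\<eta> \<le> 1"
  shows "\<bar>kern \<eta> t\<bar> \<le> 16 * \<eta> * (cmod t)^2 / (\<eta> + cmod t)^4"
proof (cases "t = 0 \<or> \<eta> = 0")
  case True
  then show ?thesis by (auto simp: kern_def)
next
  case False
  define r where "r = cmod t"
  have pos: "r > 0" "\<eta> > 0" using False \<eta> by (auto simp: r_def)
  define b where "b = (of_real \<eta>)^2 - t^2"
  have "(\<eta> + r)^2 / 4 \<le> cmod b"
    using denominator_lower_bound[OF assms] sum_squares_ge_half_square[of \<eta> r]
    by (simp add: b_def r_def)
  then have "((\<eta> + r)^2 / 4)^2 \<le> (cmod b)^2" by (rule power_mono) simp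
  then have b2: "(\<eta> + r)^4 / 16 \<le> (cmod b)^2" by (simp add: power_divide)
  have "\<bar>kern \<eta> t\<bar> \<le> \<eta> * cmod (t^2 / b^2)"
    unfolding kern_def b_def abs_mult using pos abs_Re_le_cmod by simp
  also have "\<dots> = \<eta> * r^2 / (cmod b)^2" by (simp add: norm_divide norm_power r_def)
  also have "\<dots> \<le> \<eta> * r^2 / ((\<eta> + r)^4 / 16)"
    using b2 pos by (intro divide_left_mono) (auto intro!: mult_pos_pos)
  finally show ?thesis by (simp add: r_def field_simps)
qed

text \<open>This weaker decay has an integral over \<open>\<eta>\<close> bounded independently of
  \<open>t\<close>, which gives integrability uniformly along the circle.\<close>

lemma kern_bound':
  assumes t: "t \<in> circ" and \<eta>: "0 \<le> \<eta>" "\<eta> \<le> 1"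
  shows "\<bar>kern \<eta> t\<bar> \<le> 16 * (cmod t / (\<eta> + cmod t)^2)"
proof (cases "t = 0")
  case True
  then show ?thesis by (auto simp: kern_def)
next
  case False
  define r where "r = cmod t"
  have r: "r > 0" using False by (simp add: r_def)
  have "\<eta> * r \<le> (\<eta> + r)^2"
    using \<eta> r by (simp add: power2_eq_square algebra_simps)
  then have "(\<eta> * r) * (16 * r) / (\<eta> + r)^4 \<le> (\<eta> + r)^2 * (16 * r) / (\<eta> + r)^4"
    using \<eta> r by (intro divide_right_mono mult_right_mono) auto
  also have "\<dots> = 16 * (r / (\<eta> + r)^2)"
  proof -
    define c where "c = \<eta> + r"
    have "c > 0" using \<eta> r by (simp add: c_def)
    then show ?thesis
      unfolding c_def[symmetric] by (simp add: power2_eq_square power4_eq_xxxx)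
  qed
  finally show ?thesis
    using kern_bound[OF assms] unfolding r_def[symmetric] by (simp add: power2_eq_square mult_ac)
qed

text \<open>The difference of the two fractions has a numerator divisible by \<open>t - s\<close>,
  which contributes \<open>\<delta>\<close>. The condition \<open>2 * \<delta> < |t|\<close> forces
  \<open>|s| \<ge> |t|/2\<close>, so both denominators are bounded below in terms of
  \<open>\<eta> + |t|\<close>.\<close>

lemma kern_diff_bound:
  assumes t: "t \<in> circ" and s: "s \<in> circ" and \<eta>: "0 \<le> \<eta>" "\<eta> \<le> 1"
    and near: "cmod (t - s) \<le> \<delta>" "2 * \<delta> < cmod t" "cmod s \<le> cmod t"
  shows "\<bar>kern \<eta> t - kern \<eta> s\<bar> \<le> 512 * \<eta> * \<delta> * cmod t / (\<eta> + cmod t)^4"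
proof -
  define r p where "r = cmod t" and "p = cmod s"
  have \<delta>: "\<delta> \<ge> 0" using near(1) norm_ge_zero order_trans by blast
  have r: "r > 0" using near \<delta> unfolding r_def by linarith
  have p: "r / 2 \<le> p" "p \<le> r" using near norm_triangle_ineq2[of t s] by (auto simp: r_def p_def)
  define a b c where "a = (of_real \<eta> :: complex)^2" and "b = a - t^2" and "c = a - s^2"
  have b: "(\<eta>^2 + r^2)/2 \<le> cmod b" and c: "(\<eta>^2 + p^2)/2 \<le> cmod c"
    using denominator_lower_bound[OF t \<eta>] denominator_lower_bound[OF s \<eta>]
    by (auto simp: a_def b_def c_def r_def p_def)
  have r2: "\<eta>^2 + r^2 > 0" "\<eta>^2 + p^2 > 0" using r p by (auto intro: add_nonneg_pos)
  have ne: "b \<noteq> 0" "c \<noteq> 0" using b c r2 by auto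
  have "t^2 / b^2 - s^2 / c^2 = (t^2 * c^2 - s^2 * b^2) / (b^2 * c^2)"
    using ne by (simp add: field_simps)
  also have "t^2 * c^2 - s^2 * b^2 = (t - s) * (t + s) * (a^2 - t^2 * s^2)"
    unfolding b_def c_def by (simp add: power2_eq_square algebra_simps)
  finally have "cmod (t^2 / b^2 - s^2 / c^2)
      = cmod (t - s) * cmod (t + s) * cmod (a^2 - t^2 * s^2) / ((cmod b)^2 * (cmod c)^2)"
    by (simp add: norm_divide norm_mult norm_power)
  also have "\<dots> \<le> \<delta> * (2 * r) * ((\<eta>^2 + r^2) * (\<eta>^2 + p^2)) / (((\<eta>^2 + r^2)/2)^2 * ((\<eta>^2 + p^2)/2)^2)"
  proof (intro frac_le mult_mono)
    show "cmod (t + s) \<le> 2 * r"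
      using norm_triangle_ineq[of t s] p by (simp add: r_def p_def)
    have "cmod (a^2 - t^2 * s^2) \<le> cmod (a^2) + cmod (t^2 * s^2)" by (rule norm_triangle_ineq4)
    also have "\<dots> = (\<eta>^2)^2 + r^2 * p^2" by (simp add: a_def norm_mult norm_power r_def p_def)
    also have "\<dots> \<le> (\<eta>^2 + r^2) * (\<eta>^2 + p^2)"
    proof -
      have "0 \<le> \<eta>^2 * p^2 + \<eta>^2 * r^2" by simp
      then show ?thesis by (simp add: distrib_left distrib_right power2_eq_square[of "\<eta>^2"] mult_ac)
    qed
    finally show "cmod (a^2 - t^2 * s^2) \<le> (\<eta>^2 + r^2) * (\<eta>^2 + p^2)" .
  qed (use near \<delta> r r2 b c in \<open>auto intro!: power_mono mult_nonneg_nonneg mult_pos_pos\<close>)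
  also have "\<dots> = 32 * \<delta> * r / ((\<eta>^2 + r^2) * (\<eta>^2 + p^2))"
  proof -
    have "\<delta> * (2 * r) * (X * Y) / ((X / 2)^2 * (Y / 2)^2) = 32 * \<delta> * r / (X * Y)"
      if "X > 0" "Y > 0" for X Y :: real
      using that by (simp add: power2_eq_square)
    then show ?thesis using r2 by blast
  qed
  also have "\<dots> \<le> 32 * \<delta> * r / ((\<eta> + r)^4 / 16)"
  proof (intro divide_left_mono)
    have 1: "(\<eta> + r)^2 / 2 \<le> \<eta>^2 + r^2" using sum_squares_ge_half_square[of \<eta> r] by simp
    have "(r/2)^2 \<le> p^2" using p r by (intro power_mono) auto
    then have "r^2 \<le> 4 * p^2" by (simp add: power_divide)
    then have 2: "(\<eta> + r)^2 / 8 \<le> \<eta>^2 + p^2"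
      using 1 zero_le_power2[of \<eta>] by linarith
    have "((\<eta> + r)^2 / 2) * ((\<eta> + r)^2 / 8) \<le> (\<eta>^2 + r^2) * (\<eta>^2 + p^2)"
      using 1 2 r2 by (intro mult_mono) auto
    then show "(\<eta> + r)^4 / 16 \<le> (\<eta>^2 + r^2) * (\<eta>^2 + p^2)"
      by (simp add: power2_eq_square power4_eq_xxxx)
  qed (use r r2 \<delta> \<eta> in \<open>auto intro!: mult_pos_pos divide_pos_pos\<close>)
  finally have *: "cmod (t^2 / b^2 - s^2 / c^2) \<le> 512 * \<delta> * r / (\<eta> + r)^4" by simp
  have "kern \<eta> t - kern \<eta> s = \<eta> * Re (t^2 / b^2 - s^2 / c^2)"
    by (simp add: kern_def a_def b_def c_def algebra_simps)
  then have "\<bar>kern \<eta> t - kern \<eta> s\<bar> \<le> \<eta> * cmod (t^2 / b^2 - s^2 / c^2)"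
    using \<eta> abs_Re_le_cmod[of "t^2 / b^2 - s^2 / c^2"] by (auto simp: abs_mult intro: mult_left_mono)
  also have "\<dots> \<le> \<eta> * (512 * \<delta> * r / (\<eta> + r)^4)"
    using * \<eta> by (intro mult_left_mono)
  finally show ?thesis by (simp add: r_def mult_ac)
qed

text \<open>The integrand has the antiderivative \<open>- r / (\<eta> + r)\<close>. It is a dilation
  of \<open>1 / (\<eta> + 1)^2\<close>, which explains a bound independent of
  \<open>r\<close>.\<close>

lemma set_integral_dilation_kernel:
  assumes "r > 0"
  shows "set_integrable lborel {0..1} (\<lambda>\<eta>::real. r / (\<eta> + r)^2)"
    and "(LINT \<eta>:{0..1}|lborel. r / (\<eta> + r)^2) \<le> 1"
proof -
  have c: "continuous_on {0..1} (\<lambda>\<eta>::real. r / (\<eta> + r)^2)"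
    using assms by (intro continuous_intros) auto
  then show "set_integrable lborel {0..1} (\<lambda>\<eta>::real. r / (\<eta> + r)^2)"
    by (rule borel_integrable_atLeastAtMost')
  have "(LINT \<eta>:{0..1}|lborel. r / (\<eta> + r)^2) = - r / (1 + r) - - r / (0 + r)"
    unfolding set_lebesgue_integral_def
  proof (rule integral_FTC_atLeastAtMost[OF _ _ c])
    fix x :: real assume "0 \<le> x" "x \<le> 1"
    then show "((\<lambda>\<eta>. - r / (\<eta> + r)) has_vector_derivative r / (x + r)\<^sup>2) (at x within {0..1})"
      using assms unfolding has_real_derivative_iff_has_vector_derivative[symmetric]
      by (auto intro!: derivative_eq_intros simp: power2_eq_square)
  qed simp
  also have "\<dots> \<le> 1" using assms by simp
  finally show "(LINT \<eta>:{0..1}|lborel. r / (\<eta> + r)^2) \<le> 1" .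
qed

lemma set_integral_le_dilation_kernel:
  fixes F :: "real \<Rightarrow> real"
  assumes r: "r > 0" and F: "F \<in> borel_measurable borel"
    and bound: "\<And>\<eta>. 0 \<le> \<eta> \<Longrightarrow> \<eta> \<le> 1 \<Longrightarrow> \<bar>F \<eta>\<bar> \<le> C * (r / (\<eta> + r)^2)"
  shows "set_integrable lborel {0..1} F" "(LINT \<eta>:{0..1}|lborel. \<bar>F \<eta>\<bar>) \<le> C"
    "\<bar>LINT \<eta>:{0..1}|lborel. F \<eta>\<bar> \<le> C"
proof -
  have C: "C \<ge> 0" 
    using order_trans[OF abs_ge_zero bound[of 0]] r by (simp add: zero_le_mult_iff zero_le_divide_iff)
  note k = set_integral_dilation_kernel[OF r]
  have ki: "set_integrable lborel {0..1} (\<lambda>\<eta>. C * (r / (\<eta> + r)^2))"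
    using k(1) by (rule set_integrable_mult_right)
  show Fi: "set_integrable lborel {0..1} F"
    by (rule set_integrable_bound[OF ki]) (use F bound r C in \<open>auto simp: set_borel_measurable_def abs_mult\<close>)
  have Fi': "set_integrable lborel {0..1} (\<lambda>\<eta>. \<bar>F \<eta>\<bar>)" using Fi by (rule set_integrable_abs)
  have "(LINT \<eta>:{0..1}|lborel. \<bar>F \<eta>\<bar>) \<le> (LINT \<eta>:{0..1}|lborel. C * (r / (\<eta> + r)^2))"
    using bound by (intro set_integral_mono Fi' ki) auto
  also have "\<dots> \<le> C * 1" unfolding set_integral_mult_right using k(2) C by (intro mult_left_mono)
  finally show *: "(LINT \<eta>:{0..1}|lborel. \<bar>F \<eta>\<bar>) \<le> C" by simp
  have "\<bar>LINT \<eta>:{0..1}|lborel. F \<eta>\<bar> \<le> (LINT \<eta>:{0..1}|lborel. \<bar>F \<eta>\<bar>)"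
    using set_integral_norm_bound[OF Fi] by simp
  with * show "\<bar>LINT \<eta>:{0..1}|lborel. F \<eta>\<bar> \<le> C" by simp
qed

text \<open>Both arguments vary, because Fubini's theorem needs joint measurability in
  \<open>\<eta>\<close> and the parameter of the circle.\<close>

lemma kern_measurable [measurable (raw)]:
  assumes [measurable]: "f \<in> borel_measurable M" "h \<in> borel_measurable M"
  shows "(\<lambda>x. kern (f x) (h x)) \<in> borel_measurable M"
proof -
  have [measurable]: "(\<lambda>x. complex_of_real (f x)) \<in> borel_measurable M"
    by (rule measurable_compose[OF assms(1) borel_measurable_of_real])
  show ?thesis
    unfolding kern_def by measurable
qed

section \<open>The modulus of continuity of the potential\<close>

text \<open>
  Extending the majorant by \<open>0\<close> to \<open>x \<le> 0\<close> makes it monotone on the whole line, hence Borel.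
\<close>

locale majorant =
  fixes m :: "real \<Rightarrow> real" and \<sigma> :: real
  assumes m_mono: "mono m" and m_zero: "x \<le> 0 \<Longrightarrow> m x = 0" and \<sigma>: "\<sigma> \<ge> 1"
    and m_scale: "1 \<le> l \<Longrightarrow> 0 < x \<Longrightarrow> m (l * x) \<le> \<sigma> * l * m x"
    and m_tendsto: "(m \<longlongrightarrow> 0) (at_right 0)"
begin

lemma m_nonneg: "0 \<le> m x"
  using m_zero[of "min x 0"] monoD[OF m_mono, of "min x 0" x] by simp

lemma m_le:
  assumes "0 < r" "r \<le> x"
  shows "m x \<le> \<sigma> * (x / r) * m r"
  using m_scale[of "x / r" r] assms by simp

text \<open>Replacing \<open>x\<close> by \<open>x + r\<close> avoids distinguishing
  \<open>x < r\<close> from \<open>x \<ge> r\<close>.\<close>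

lemma m_le_add:
  assumes "0 < r" "0 \<le> x"
  shows "m x \<le> \<sigma> * ((x + r) / r) * m r"
proof -
  have "m x \<le> m (x + r)" using assms by (intro monoD[OF m_mono]) auto
  also have "\<dots> \<le> \<sigma> * ((x + r) / r) * m r" using assms by (intro m_le) auto
  finally show ?thesis .
qed

lemma m_measurable [measurable]: "m \<in> borel_measurable borel"
  using m_mono by (rule borel_measurable_mono)

lemma m_le_one: "x \<le> 1 \<Longrightarrow> m x \<le> m 1"
  using m_mono by (rule monoD)

lemma set_integrable_m_mult:
  assumes "continuous_on {0..1} f"
  shows "set_integrable lborel {0..1} (\<lambda>\<eta>. m \<eta> * f \<eta>)"
proof (rule set_integrable_bound)
  have f: "set_integrable lborel {0..1} f"
    using assms by (rule borel_integrable_atLeastAtMost')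
  then show "set_integrable lborel {0..1} (\<lambda>\<eta>. m 1 * f \<eta>)"
    by (rule set_integrable_mult_right)
  have "(\<lambda>x. indicator {0..1} x * f x) \<in> borel_measurable borel"
    using f by (auto simp: set_integrable_def dest: borel_measurable_integrable)
  then have "(\<lambda>x. m x * (indicator {0..1} x * f x)) \<in> borel_measurable borel" by measurable
  then show "set_borel_measurable lborel {0..1} (\<lambda>\<eta>. m \<eta> * f \<eta>)"
    by (simp add: set_borel_measurable_def mult_ac)
  show "AE x in lborel. x \<in> {0..1} \<longrightarrow> norm (m x * f x) \<le> norm (m 1 * f x)"
    using m_le_one by (auto simp: abs_mult m_nonneg intro!: mult_right_mono)
qed

text \<open>On the circle this is \<open>g\<close>, written as a Lebesgue integral so that
  domination and Fubini's theorem apply.\<close>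

definition pot :: "complex \<Rightarrow> real" where
  "pot t = 8 * (LINT \<eta>:{0..1}|lborel. m \<eta> * kern \<eta> t)"

lemma kern_integrable:
  assumes t: "t \<in> circ"
  shows "set_integrable lborel {0..1} (\<lambda>\<eta>. m \<eta> * kern \<eta> t)"
    and "(LINT \<eta>:{0..1}|lborel. \<bar>m \<eta> * kern \<eta> t\<bar>) \<le> 16 * m 1"
proof -
  have *: "set_integrable lborel {0..1} (\<lambda>\<eta>. m \<eta> * kern \<eta> t) \<and>
    (LINT \<eta>:{0..1}|lborel. \<bar>m \<eta> * kern \<eta> t\<bar>) \<le> 16 * m 1"
  proof (cases "t = 0")
    case True
    then show ?thesis by (simp add: kern_def m_nonneg set_integrable_def)
  next
    case False
    have "\<bar>m \<eta> * kern \<eta> t\<bar> \<le> (16 * m 1) * (cmod t / (\<eta> + cmod t)^2)" if "0 \<le> \<eta>" "\<eta> \<le> 1" for \<eta>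
      using mult_mono[OF m_le_one[OF that(2)] kern_bound'[OF t that]] 
      by (simp add: abs_mult m_nonneg mult_ac)
    note b = set_integral_le_dilation_kernel[OF _ _ this]
    show ?thesis using b(1,2) False by (intro conjI) simp_all
  qed
  show "set_integrable lborel {0..1} (\<lambda>\<eta>. m \<eta> * kern \<eta> t)" using * by blast
  show "(LINT \<eta>:{0..1}|lborel. \<bar>m \<eta> * kern \<eta> t\<bar>) \<le> 16 * m 1" using * by blast
qed

text \<open>The growth factor \<open>(\<eta> + r)/r\<close> of \<open>m\<close> uses up one power of
  the decay of \<open>kern\<close>. Bounding the remaining \<open>\<eta>\<close> by
  \<open>\<eta> + r\<close> leaves a multiple of the dilation kernel, whose integral is at most
  1.\<close>

lemma pot_bound:
  assumes t: "t \<in> circ"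
  shows "\<bar>pot t\<bar> \<le> 128 * \<sigma> * m (cmod t)"
proof (cases "t = 0")
  case True
  then show ?thesis by (simp add: pot_def kern_def m_zero)
next
  case False
  define r where "r = cmod t"
  have r: "r > 0" using False by (simp add: r_def)
  have "\<bar>m \<eta> * kern \<eta> t\<bar> \<le> (16 * \<sigma> * m r) * (r / (\<eta> + r)^2)" if \<eta>: "0 \<le> \<eta>" "\<eta> \<le> 1" for \<eta>
  proof -
    define c where "c = \<eta> + r"
    have c: "c > 0" "\<eta> \<le> c" using \<eta> r by (auto simp: c_def)
    have "\<bar>m \<eta> * kern \<eta> t\<bar> = m \<eta> * \<bar>kern \<eta> t\<bar>" by (simp add: abs_mult m_nonneg)
    also have "\<dots> \<le> (\<sigma> * (c / r) * m r) * (16 * \<eta> * r^2 / c^4)"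
      using m_le_add[OF r \<eta>(1)] kern_bound[OF t \<eta>] \<sigma> c r \<eta>
      unfolding c_def r_def by (intro mult_mono) (auto simp: m_nonneg)
    also have "\<dots> = (16 * \<sigma> * m r * r / c^3) * \<eta>"
      using r c by (simp add: field_simps power2_eq_square power3_eq_cube power4_eq_xxxx)
    also have "\<dots> \<le> (16 * \<sigma> * m r * r / c^3) * c"
      using r c \<sigma> by (intro mult_left_mono) (auto simp: m_nonneg)
    also have "\<dots> = (16 * \<sigma> * m r) * (r / c^2)"
      using c by (simp add: power2_eq_square power3_eq_cube)
    finally show ?thesis by (simp add: c_def)
  qed
  note set_integral_le_dilation_kernel(3)[OF r _ this]
  then have "\<bar>LINT \<eta>:{0..1}|lborel. m \<eta> * kern \<eta> t\<bar> \<le> 16 * \<sigma> * m r" by simp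
  then show ?thesis by (simp add: pot_def r_def abs_mult)
qed

text \<open>Near 0, when \<open>|t| \<le> 2 * \<delta>\<close>, the sizes of the two values suffice.
  Farther away the difference of kernels gains a factor \<open>\<delta> / r\<close>, which makes up
  for the at most linear growth of \<open>m\<close> from \<open>\<delta>\<close> to
  \<open>r\<close>.\<close>

lemma pot_diff_bound_aux:
  assumes t: "t \<in> circ" and s: "s \<in> circ" and "0 < \<delta>"
    and near: "cmod (t - s) \<le> \<delta>" "cmod s \<le> cmod t"
  shows "\<bar>pot t - pot s\<bar> \<le> 4096 * \<sigma>^2 * m \<delta>"
proof (cases "2 * \<delta> < cmod t")
  case True
  define r where "r = cmod t"
  have r: "r > 0" "\<delta> \<le> r" using True \<open>0 < \<delta>\<close> by (auto simp: r_def)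
  have "\<bar>m \<eta> * kern \<eta> t - m \<eta> * kern \<eta> s\<bar> \<le> (512 * \<sigma> * m r * (\<delta> / r)) * (r / (\<eta> + r)^2)"
    if \<eta>: "0 \<le> \<eta>" "\<eta> \<le> 1" for \<eta>
  proof -
    define c where "c = \<eta> + r"
    have c: "c > 0" "\<eta> \<le> c" using \<eta> r by (auto simp: c_def)
    have "\<bar>m \<eta> * kern \<eta> t - m \<eta> * kern \<eta> s\<bar> = m \<eta> * \<bar>kern \<eta> t - kern \<eta> s\<bar>"
      by (simp add: abs_mult m_nonneg right_diff_distrib[symmetric])
    also have "\<dots> \<le> (\<sigma> * (c / r) * m r) * (512 * \<eta> * \<delta> * r / c^4)"
      using m_le_add[OF r(1) \<eta>(1)] kern_diff_bound[OF t s \<eta> near(1) True near(2)] \<sigma> c r \<eta>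
      unfolding c_def r_def by (intro mult_mono) (auto simp: m_nonneg)
    also have "\<dots> = (512 * \<sigma> * m r * \<delta> / c^3) * \<eta>"
      using r c by (simp add: field_simps power2_eq_square power3_eq_cube power4_eq_xxxx)
    also have "\<dots> \<le> (512 * \<sigma> * m r * \<delta> / c^3) * c"
      using r c \<sigma> \<open>0 < \<delta>\<close> by (intro mult_left_mono) (auto simp: m_nonneg)
    also have "\<dots> = (512 * \<sigma> * m r * (\<delta> / r)) * (r / c^2)"
      using c r by (simp add: power2_eq_square power3_eq_cube)
    finally show ?thesis by (simp add: c_def)
  qed
  note set_integral_le_dilation_kernel(3)[OF r(1) _ this]
  then have "\<bar>LINT \<eta>:{0..1}|lborel. m \<eta> * kern \<eta> t - m \<eta> * kern \<eta> s\<bar> \<le> 512 * \<sigma> * m r * (\<delta> / r)"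
    by simp
  also have "\<dots> \<le> 512 * \<sigma> * (\<sigma> * (r / \<delta>) * m \<delta>) * (\<delta> / r)"
    using m_le[of \<delta> r] r \<open>0 < \<delta>\<close> \<sigma> by (intro mult_right_mono mult_left_mono) auto
  also have "\<dots> = 512 * \<sigma>^2 * m \<delta>" using r \<open>0 < \<delta>\<close> by (simp add: power2_eq_square)
  finally have "8 * \<bar>LINT \<eta>:{0..1}|lborel. m \<eta> * kern \<eta> t - m \<eta> * kern \<eta> s\<bar> \<le> 4096 * \<sigma>^2 * m \<delta>"
    by (simp add: mult_ac)
  moreover have "pot t - pot s = 8 * (LINT \<eta>:{0..1}|lborel. m \<eta> * kern \<eta> t - m \<eta> * kern \<eta> s)"
    unfolding pot_def set_integral_diff(2)[OF kern_integrable(1)[OF t] kern_integrable(1)[OF s]]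
    by simp
  ultimately show ?thesis by (simp add: abs_mult)
next
  case False
  have "\<bar>pot t - pot s\<bar> \<le> \<bar>pot t\<bar> + \<bar>pot s\<bar>" by (rule abs_triangle_ineq4)
  also have "\<dots> \<le> 128 * \<sigma> * m (cmod t) + 128 * \<sigma> * m (cmod s)"
    using pot_bound[OF t] pot_bound[OF s] by (rule add_mono)
  also have "\<dots> \<le> 128 * \<sigma> * m (2 * \<delta>) + 128 * \<sigma> * m (2 * \<delta>)"
    using False near(2) \<sigma> by (intro add_mono mult_left_mono monoD[OF m_mono]) auto
  also have "\<dots> \<le> 256 * \<sigma> * (\<sigma> * 2 * m \<delta>)"
    using m_scale[of 2 \<delta>] \<open>0 < \<delta>\<close> \<sigma> by simp
  also have "\<dots> \<le> 4096 * \<sigma>^2 * m \<delta>"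
    using m_nonneg[of \<delta>] using \<sigma> by (simp add: power2_eq_square mult_right_mono)
  finally show ?thesis .
qed

lemma pot_diff_bound:
  assumes "t \<in> circ" "s \<in> circ" "0 < \<delta>" "cmod (t - s) \<le> \<delta>"
  shows "\<bar>pot t - pot s\<bar> \<le> 4096 * \<sigma>^2 * m \<delta>"
proof (cases "cmod s \<le> cmod t")
  case True
  then show ?thesis using pot_diff_bound_aux assms by blast
next
  case False
  then show ?thesis
    using pot_diff_bound_aux[of s t \<delta>] assms by (simp add: abs_minus_commute norm_minus_commute)
qed

lemma pot_continuous: "continuous_on circ pot"
  unfolding continuous_on_iff
proof (intro ballI allI impI)
  fix s and e :: real assume s: "s \<in> circ" and e: "e > 0"
  define C where "C = 4096 * \<sigma>^2"
  have C: "C > 0" using \<sigma> by (simp add: C_def)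
  have "\<forall>\<^sub>F x in at_right 0. m x < e / C"
    using m_tendsto e C by (intro order_tendstoD) auto
  then have "\<forall>\<^sub>F x in at_right 0. m x < e / C \<and> 0 < x"
    by (intro eventually_conj eventually_at_right_less)
  then obtain \<delta> where \<delta>: "m \<delta> < e / C" "0 < \<delta>"
    using eventually_happens'[OF trivial_limit_at_right_real] by blast
  have "dist (pot t) (pot s) < e" if "t \<in> circ" "dist t s < \<delta>" for t
  proof -
    have "\<bar>pot t - pot s\<bar> \<le> C * m \<delta>"
      unfolding C_def using that \<delta> s by (intro pot_diff_bound) (auto simp: dist_norm)
    also have "\<dots> < e" using \<delta> C by (simp add: field_simps)
    finally show ?thesis by (simp add: dist_real_def)
  qed
  then show "\<exists>\<delta>>0. \<forall>t\<in>circ. dist t s < \<delta> \<longrightarrow> dist (pot t) (pot s) < e" using \<delta>(2) by blast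
qed

end

section \<open>Poisson averages\<close>

text \<open>
  On the unit circle \<open>Re (\<zeta> / (\<zeta> - w))\<close> equals \<open>(\<zeta> / (\<zeta> - w) + 1 / (1 - w \<zeta>)) / 2\<close> for real \<open>w\<close>,
  which is meromorphic in \<open>\<zeta>\<close>.
\<close>

lemma Poisson_average:
  fixes w :: real
  assumes "((\<lambda>t. f t / (t - of_real (w - 1)) + f t / ((t + 1) * (1 - of_real w * (t + 1))))
      has_contour_integral (2 * of_real pi * \<i> * J)) (circlepath (-1) 1)"
    and w: "\<bar>w\<bar> \<noteq> 1"
  shows "((\<lambda>s. Re (f (circlepath (-1) 1 s)) * Re ((circlepath (-1) 1 s + 1) / (circlepath (-1) 1 s + 1 - of_real w)))
      has_integral (Re J / 2)) {0..1}"
proof -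
  define \<zeta> where "\<zeta> s = exp (2 * of_real pi * \<i> * of_real s)" for s :: real
  have c: "circlepath (-1) 1 s = \<zeta> s - 1" for s by (simp add: circlepath \<zeta>_def mult_ac)
  have n: "cmod (\<zeta> s) = 1" for s by (simp add: \<zeta>_def norm_exp_eq_Re)
  let ?F = "\<lambda>s. (f (\<zeta> s - 1) / (\<zeta> s - of_real w) + f (\<zeta> s - 1) / (\<zeta> s * (1 - of_real w * \<zeta> s))) * (2 * of_real pi * \<i> * \<zeta> s)"
  have "(?F has_integral (2 * of_real pi * \<i> * J)) {0..1}"
    using assms(1) unfolding has_contour_integral_def
    by (rule has_integral_eq[rotated])
       (auto simp: vector_derivative_circlepath01 c, auto simp: \<zeta>_def mult_ac)
  \<comment> \<open>The factor \<open>1 / (2 pi i)\<close> cancels the constant in the derivative of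
    the circle path; the extra half is the one in the formula for the real part of the
    kernel.\<close>
  then have "((\<lambda>s. 1 / (4 * of_real pi * \<i>) * ?F s) has_integral (1 / (4 * of_real pi * \<i>) * (2 * of_real pi * \<i> * J))) {0..1}"
    by (rule has_integral_mult_right)
  moreover have "1 / (4 * of_real pi * \<i>) * ?F s = f (\<zeta> s - 1) * of_real (Re (\<zeta> s / (\<zeta> s - of_real w)))" for s
  proof -
    have z: "\<zeta> s \<noteq> 0" using n[of s] by auto
    have cz: "cnj (\<zeta> s) = 1 / \<zeta> s"
      using complex_norm_square[of "\<zeta> s"] n[of s] z by (simp add: field_simps)
    have "cmod (\<zeta> s) \<noteq> cmod (of_real w)" using n w by simp
    then have 1: "\<zeta> s - of_real w \<noteq> 0" by auto
    have "cmod (of_real w * \<zeta> s) \<noteq> 1" using n w by (simp add: norm_mult)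
    then have 2: "1 - of_real w * \<zeta> s \<noteq> 0" by auto
    have "2 * of_real (Re (\<zeta> s / (\<zeta> s - of_real w))) = \<zeta> s / (\<zeta> s - of_real w) + cnj (\<zeta> s / (\<zeta> s - of_real w))"
      by (subst complex_add_cnj) simp
    also have "cnj (\<zeta> s / (\<zeta> s - of_real w)) = 1 / (1 - of_real w * \<zeta> s)"
      using z by (simp add: cz field_simps)
    finally have *: "complex_of_real (Re (\<zeta> s / (\<zeta> s - of_real w))) = (\<zeta> s / (\<zeta> s - of_real w) + 1 / (1 - of_real w * \<zeta> s)) / 2"
      by (simp add: mult.commute)
    have "1 / (4 * of_real pi * \<i>) * ((x / a + x / (y * b)) * (2 * of_real pi * \<i> * y)) = x * ((y / a + 1 / b) / 2)"
      if "a \<noteq> 0" "b \<noteq> 0" "y \<noteq> 0" for x y a b :: complex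
      using that by (simp add: field_simps)
    from this[OF 1 2 z] show ?thesis unfolding * .
  qed
  moreover have "1 / (4 * of_real pi * \<i>) * (2 * of_real pi * \<i> * J) = J / 2" by simp
  ultimately have "((\<lambda>s. f (\<zeta> s - 1) * of_real (Re (\<zeta> s / (\<zeta> s - of_real w)))) has_integral (J / 2)) {0..1}"
    by simp
  \<comment> \<open>The kernel is now a real factor, so taking real parts acts on \<open>f\<close>
    alone.\<close>
  from has_integral_linear[OF this bounded_linear_Re]
  show ?thesis by (simp add: o_def c)
qed

text \<open>Cauchy's formula is applied to each summand: the first has its pole at
  \<open>w - 1\<close>, the second only at the centre \<open>-1\<close>, as
  \<open>1 - w (t + 1)\<close> has no zero in the closed disc.\<close>

lemma Poisson_average_inside:
  fixes w :: real
  assumes f: "f holomorphic_on cball (-1) 1" and w: "\<bar>w\<bar> < 1"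
  shows "((\<lambda>s. Re (f (circlepath (-1) 1 s)) * Re ((circlepath (-1) 1 s + 1) / (circlepath (-1) 1 s + 1 - of_real w)))
      has_integral (Re (f (-1) + f (of_real (w - 1))) / 2)) {0..1}"
proof (rule Poisson_average)
  have ne: "1 - of_real w * (t + 1) \<noteq> 0" if "t \<in> cball (-1) 1" for t :: complex
  proof -
    have "cmod (of_real w * (t + 1)) \<le> \<bar>w\<bar> * 1"
      using that unfolding norm_mult by (intro mult_mono) (auto simp: dist_norm norm_minus_commute)
    then show ?thesis using w by auto
  qed
  have 1: "((\<lambda>t. f t / (t - of_real (w - 1))) has_contour_integral (2 * of_real pi * \<i> * f (of_real (w - 1)))) (circlepath (-1) 1)"
    using f w by (intro Cauchy_integral_circlepath_simple) auto
  have "((\<lambda>t. (f t / (1 - of_real w * (t + 1))) / (t - (-1))) has_contour_integral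
      (2 * of_real pi * \<i> * (f (-1) / (1 - of_real w * (-1 + 1))))) (circlepath (-1) 1)"
    using f ne by (intro Cauchy_integral_circlepath_simple holomorphic_intros) auto
  then have 2: "((\<lambda>t. f t / ((t + 1) * (1 - of_real w * (t + 1)))) has_contour_integral
      (2 * of_real pi * \<i> * f (-1))) (circlepath (-1) 1)"
    by (simp add: mult_ac)
  show "((\<lambda>t. f t / (t - of_real (w - 1)) + f t / ((t + 1) * (1 - of_real w * (t + 1))))
      has_contour_integral (2 * of_real pi * \<i> * (f (-1) + f (of_real (w - 1))))) (circlepath (-1) 1)"
    using has_contour_integral_add[OF 1 2] by (simp add: algebra_simps)
qed (use w in auto)

text \<open>Now the first summand is holomorphic in the disc and contributes 0. With
  \<open>z = t + 1\<close>, the partial fractions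
  \<open>1 / (z (1 - w z)) = 1 / z - 1 / (z - 1 / w)\<close> bring in the reflection
  \<open>1 / w - 1\<close> of the point \<open>w - 1\<close>, with a minus sign.\<close>

lemma Poisson_average_outside:
  fixes w :: real
  assumes f: "f holomorphic_on cball (-1) 1" and w: "1 < \<bar>w\<bar>"
  shows "((\<lambda>s. Re (f (circlepath (-1) 1 s)) * Re ((circlepath (-1) 1 s + 1) / (circlepath (-1) 1 s + 1 - of_real w)))
      has_integral (Re (f (-1) - f (of_real (1 / w - 1))) / 2)) {0..1}"
proof (rule Poisson_average)
  have w0: "w \<noteq> 0" and iw: "\<bar>1 / w\<bar> < 1" using w by auto
  have "t - of_real (w - 1) \<noteq> 0" if "t \<in> cball (-1) 1" for t :: complex
  proof
    assume "t - of_real (w - 1) = 0"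
    then have "t + 1 = of_real w" by simp
    then have "cmod (t + 1) = \<bar>w\<bar>" by simp
    moreover have "cmod (t + 1) \<le> 1" using that by (auto simp: dist_norm norm_minus_commute)
    ultimately show False using w by simp
  qed
  then have "(\<lambda>t. f t / (t - of_real (w - 1))) holomorphic_on cball (-1) 1"
    using f by (intro holomorphic_intros) auto
  then have 1: "((\<lambda>t. f t / (t - of_real (w - 1))) has_contour_integral 0) (circlepath (-1) 1)"
    by (rule Cauchy_theorem_convex_simple) auto
  have 2: "((\<lambda>t. f t / (t - (-1))) has_contour_integral (2 * of_real pi * \<i> * f (-1))) (circlepath (-1) 1)"
    using f by (intro Cauchy_integral_circlepath_simple) auto
  have 3: "((\<lambda>t. f t / (t - of_real (1 / w - 1))) has_contour_integral
      (2 * of_real pi * \<i> * f (of_real (1 / w - 1)))) (circlepath (-1) 1)"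
    using f iw by (intro Cauchy_integral_circlepath_simple) (auto simp: norm_divide)
  have 4: "((\<lambda>t. f t / (t - of_real (w - 1)) + (f t / (t - (-1)) - f t / (t - of_real (1 / w - 1)))) has_contour_integral
      (2 * of_real pi * \<i> * (f (-1) - f (of_real (1 / w - 1))))) (circlepath (-1) 1)"
    using has_contour_integral_add[OF 1 has_contour_integral_diff[OF 2 3]] by (simp add: algebra_simps)
  show "((\<lambda>t. f t / (t - of_real (w - 1)) + f t / ((t + 1) * (1 - of_real w * (t + 1))))
      has_contour_integral (2 * of_real pi * \<i> * (f (-1) - f (of_real (1 / w - 1))))) (circlepath (-1) 1)"
  proof (rule has_contour_integral_eq[OF 4])
    fix t :: complex assume "t \<in> path_image (circlepath (-1) 1)"
    then have n: "cmod (t + 1) = 1" by (auto simp: dist_norm norm_minus_commute)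
    define z where "z = t + 1"
    have z: "z \<noteq> 0" "cmod z = 1" using n by (auto simp: z_def)
    have "cmod (of_real w * z) \<noteq> 1" using z w by (simp add: norm_mult)
    then have nz: "1 - of_real w * z \<noteq> 0" by auto
    have "z - 1 / of_real w = - (1 - of_real w * z) / of_real w" using w0 by (simp add: field_simps)
    moreover have "x / (- a / b) = - (x * b / a)" for x a b :: complex by simp
    ultimately have "x / (z - 1 / of_real w) = - (x * of_real w / (1 - of_real w * z))" for x
      by metis
    then have "x / z - x / (z - 1 / of_real w) = x / (z * (1 - of_real w * z))" for x
      using z nz w0 by (simp add: field_simps)
    from this[of "f t"] show "f t / (t - of_real (w - 1)) + (f t / (t - (-1)) - f t / (t - of_real (1 / w - 1)))
      = f t / (t - of_real (w - 1)) + f t / ((t + 1) * (1 - of_real w * (t + 1)))"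
      by (simp add: z_def algebra_simps)
  qed
qed (use w in auto)

text \<open>The second summand is \<open>t / (t + \<eta>)\<^sup>2\<close> after the substitution \<open>t \<mapsto> -t/(t+1)\<close>, up to sign.\<close>

definition hol_kern :: "real \<Rightarrow> complex \<Rightarrow> complex" where
  "hol_kern \<eta> t = (t / (t - of_real \<eta>)^2 + t * (t + 1) / (of_real (1 - \<eta>) * t - of_real \<eta>)^2) / 4"

text \<open>Partial fractions split the kernel into terms with poles at \<open>\<eta>\<close> and
  \<open>- \<eta>\<close>. The second pole lies in the disc, so that term is replaced by its
  conjugate, which has the same real part and is rational in \<open>t\<close> because
  \<open>cnj t = - t / (t + 1)\<close> on the circle.\<close>

lemma kern_eq_Re_hol_kern:
  assumes t: "t \<in> circ" and \<eta>: "0 < \<eta>" "\<eta> \<le> 1"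
  shows "kern \<eta> t = Re (hol_kern \<eta> t)"
proof (cases "t = -1")
  case True
  then show ?thesis using t by (simp add: circ_def)
next
  case False
  then have t1: "t + 1 \<noteq> 0" by (simp add: eq_neg_iff_add_eq_0)
  define e where "e = complex_of_real \<eta>"
  have Re: "2 * Re t = - ((cmod t)^2)" by (rule circ_Re[OF t])
  have "(t + 1) * cnj (t + 1) = 1"
    using t complex_norm_square[of "t + 1"] by (simp add: circ_def)
  then have "cnj t * (t + 1) + t = 0" by (simp add: algebra_simps)
  then have "cnj t * (t + 1) = - t" by (simp only: eq_neg_iff_add_eq_0)
  then have cnj_t: "cnj t = - t / (t + 1)" by (simp only: nonzero_eq_divide_eq[OF t1])
  have cnj_e: "cnj e = e" by (simp add: e_def)
  have n1: "t \<noteq> e"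
  proof
    assume "t = e"
    then have "2 * \<eta> = - (\<eta> * \<eta>)" using Re by (simp add: e_def power2_eq_square)
    then show False using \<eta> mult_pos_pos[of \<eta> \<eta>] by linarith
  qed
  have n2: "t \<noteq> - e"
  proof
    assume "t = - e"
    then have "2 * \<eta> = \<eta>^2" using Re by (simp add: e_def)
    then show False using \<eta> by (simp add: power2_eq_square)
  qed
  have k1: "e * t^2 / (e^2 - t^2)^2 = (t / (t - e)^2 - t / (t + e)^2) / 4"
  proof -
    have "e * t^2 * 4 * ((t - e)^2 * (t + e)^2) = (t * (t + e)^2 - t * (t - e)^2) * (e^2 - t^2)^2"
      by (simp add: power2_eq_square algebra_simps)
    moreover have "t - e \<noteq> 0" "t + e \<noteq> 0" "e^2 - t^2 \<noteq> 0"
      using n1 n2 by (auto simp: add_eq_0_iff2 power2_eq_iff)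
    ultimately show ?thesis by (simp add: divide_simps) (simp add: mult_ac)
  qed
  have "kern \<eta> t = Re (e * t^2 / (e^2 - t^2)^2)"
    by (simp add: kern_def e_def times_divide_eq_right[symmetric] del: times_divide_eq_right)
  then have k2: "kern \<eta> t = (Re (t / (t - e)^2) - Re (t / (t + e)^2)) / 4"
    unfolding k1 by simp
  have k3: "Re (t / (t + e)^2) = Re (- (t * (t + 1) / ((1 - e) * t - e)^2))"
  proof -
    have "cnj (t / (t + e)^2) = (- t / (t + 1)) / (- t / (t + 1) + e)^2"
      by (simp add: cnj_t cnj_e)
    also have "- t / (t + 1) + e = - ((1 - e) * t - e) / (t + 1)"
      using t1 by (simp add: field_simps)
    also have "(- t / (t + 1)) / (- ((1 - e) * t - e) / (t + 1))^2 = - (t * (t + 1) / ((1 - e) * t - e)^2)"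
    proof -
      have "(- t / y) / (- b / y)^2 = - (t * y / b^2)" if "y \<noteq> 0" for b y
        using that by (simp add: power_divide power2_eq_square)
      from this[OF t1] show ?thesis .
    qed
    finally show ?thesis by (metis cnj.sel(1))
  qed
  show ?thesis
    unfolding k2 k3 hol_kern_def of_real_diff of_real_1 e_def[symmetric] by simp
qed

text \<open>On the closed disc \<open>Re t \<le> 0\<close>, so the bases of both squared
  denominators have negative real part.\<close>

lemma hol_kern_holomorphic:
  assumes \<eta>: "0 < \<eta>" "\<eta> \<le> 1"
  shows "hol_kern \<eta> holomorphic_on cball (-1) 1"
proof -
  have "t - of_real \<eta> \<noteq> 0" "of_real (1 - \<eta>) * t - of_real \<eta> \<noteq> 0" if "t \<in> cball (-1) 1" for t :: complex
  proof -
    have "cmod (t + 1) \<le> 1" using that by (auto simp: dist_norm norm_minus_commute)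
    then have "Re t \<le> 0" using complex_Re_le_cmod[of "t + 1"] by simp
    then have "Re (t - of_real \<eta>) < 0" "Re (of_real (1 - \<eta>) * t - of_real \<eta>) < 0"
      using \<eta> mult_nonneg_nonpos[of "1 - \<eta>" "Re t"] by auto
    then show "t - of_real \<eta> \<noteq> 0" "of_real (1 - \<eta>) * t - of_real \<eta> \<noteq> 0" by (metis less_irrefl zero_complex.sel(1))+
  qed
  then show ?thesis unfolding hol_kern_def by (intro holomorphic_intros) auto
qed

section \<open>The Cauchy-type integral on the real axis\<close>

context majorant
begin

text \<open>Along the circle \<open>dt / (2 pi i (t - z))\<close> is the kernel
  \<open>\<zeta> / (\<zeta> - w)\<close> times \<open>ds\<close>, with
  \<open>\<zeta> = t + 1\<close>; only its real part matters because \<open>g\<close> is real.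
  Fubini's theorem then reduces the claim to one average per \<open>\<eta>\<close>; it applies
  because the absolute integral over \<open>\<eta>\<close> is bounded uniformly along the
  circle.\<close>

lemma Re_cauchy_type_integral_pot:
  fixes w :: real
  assumes w: "\<bar>w\<bar> \<noteq> 1" and g: "\<And>t. t \<in> circ \<Longrightarrow> g t = pot t"
    and J: "\<And>\<eta>. 0 < \<eta> \<Longrightarrow> \<eta> \<le> 1 \<Longrightarrow>
      ((\<lambda>s. kern \<eta> (circlepath (-1) 1 s) * Re ((circlepath (-1) 1 s + 1) / (circlepath (-1) 1 s + 1 - of_real w)))
        has_integral J \<eta>) {0..1}"
  shows "Re (cauchy_type_integral g (of_real (w - 1))) = 8 * (LINT \<eta>:{0..1}|lborel. m \<eta> * J \<eta>)"
proof -
  define c where "c = circlepath (-1) 1"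
  define P where "P s = Re ((c s + 1) / (c s + 1 - of_real w))" for s
  have c_circ: "c s \<in> circ" for s
    by (simp add: c_def circlepath circ_def norm_exp_eq_Re)
  have c_cont: "continuous_on A c" for A
    unfolding c_def circlepath by (intro continuous_intros)
  have c_ne: "c s + 1 - of_real w \<noteq> 0" for s
  proof -
    have "cmod (c s + 1) \<noteq> cmod (of_real w)" using c_circ[of s] w by (simp add: circ_def)
    then show ?thesis by auto
  qed
  have P_cont: "continuous_on A P" for A
    unfolding P_def using c_ne by (intro continuous_intros c_cont) auto
  have [measurable]: "c \<in> borel_measurable borel" "P \<in> borel_measurable borel"
    using c_cont P_cont by (auto intro: borel_measurable_continuous_onI)
  have pc_cont: "continuous_on {0..1} (\<lambda>s. pot (c s))"
    using c_circ by (intro continuous_on_compose2[OF pot_continuous c_cont]) auto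
  have PC: "continuous_on {0..1} (\<lambda>s. pot (c s) * P s)"
    by (intro continuous_intros pc_cont P_cont)
  obtain B where B: "\<And>s. s \<in> {0..1} \<Longrightarrow> \<bar>P s\<bar> \<le> B"
  proof -
    have "bounded (P ` {0..1})"
      by (intro compact_imp_bounded compact_continuous_image P_cont) simp
    then obtain b where "\<forall>x\<in>P ` {0..1}. norm x \<le> b" unfolding bounded_iff by blast
    then show ?thesis using that[of b] by auto
  qed
  have "Re (cauchy_type_integral g (of_real (w - 1)))
      = Re (integral {0..1} (\<lambda>s. of_real (pot (c s)) * ((c s + 1) / (c s + 1 - of_real w))))"
  proof -
    have "cauchy_type_integral g (of_real (w - 1)) = 1 / (2 * of_real pi * \<i>) *
        integral {0..1} (\<lambda>s. of_real (g (c s)) / (c s - of_real (w - 1)) * vector_derivative c (at s))"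
      unfolding cauchy_type_integral_def contour_integral_integral c_def ..
    also have "\<dots> = integral {0..1} (\<lambda>s. 1 / (2 * of_real pi * \<i>) *
        (of_real (g (c s)) / (c s - of_real (w - 1)) * vector_derivative c (at s)))"
      by (rule integral_mult_right[symmetric])
    also have "\<dots> = integral {0..1} (\<lambda>s. of_real (pot (c s)) * ((c s + 1) / (c s + 1 - of_real w)))"
    proof (rule integral_cong)
      fix s :: real
      have "vector_derivative c (at s) = 2 * of_real pi * \<i> * (c s + 1)"
        unfolding c_def vector_derivative_circlepath by (simp add: circlepath mult_ac)
      then show "1 / (2 * of_real pi * \<i>) * (of_real (g (c s)) / (c s - of_real (w - 1)) * vector_derivative c (at s))
          = of_real (pot (c s)) * ((c s + 1) / (c s + 1 - of_real w))"
        by (simp add: g[OF c_circ] algebra_simps add_divide_distrib)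
    qed
    finally show ?thesis by simp
  qed
  also have "\<dots> = integral {0..1} (\<lambda>s. pot (c s) * P s)"
  proof -
    have "(\<lambda>s. of_real (pot (c s)) * ((c s + 1) / (c s + 1 - of_real w))) integrable_on {0..1}"
      using c_ne by (intro integrable_continuous_real continuous_intros pc_cont c_cont) auto
    from integral_linear[OF this bounded_linear_Re] show ?thesis
      by (simp add: o_def P_def del: times_divide_eq_right)
  qed
  also have "\<dots> = (LINT s:{0..1}|lborel. pot (c s) * P s)"
    using set_borel_integral_eq_integral(2)[OF borel_integrable_atLeastAtMost'[OF PC]] by simp
  also have "\<dots> = 8 * (LINT s|lborel. LINT \<eta>|lborel.
      indicator {0..1} s * (indicator {0..1} \<eta> * (m \<eta> * kern \<eta> (c s) * P s)))"
    unfolding pot_def set_lebesgue_integral_def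
    by (simp add: mult_ac integral_mult_right_zero[symmetric] del: integral_mult_right_zero)
  also have "(LINT s|lborel. LINT \<eta>|lborel. indicator {0..1} s * (indicator {0..1} \<eta> * (m \<eta> * kern \<eta> (c s) * P s)))
    = (LINT \<eta>|lborel. LINT s|lborel. indicator {0..1} s * (indicator {0..1} \<eta> * (m \<eta> * kern \<eta> (c s) * P s)))"
  proof (rule lborel_pair.Fubini_integral[symmetric], rule lborel_pair.Fubini_integrable)
    let ?f = "\<lambda>(s, \<eta>). indicator {0..1} s * (indicator {0..1} \<eta> * (m \<eta> * kern \<eta> (c s) * P s)) :: real"
    show f: "?f \<in> borel_measurable (lborel \<Otimes>\<^sub>M lborel)"
      by measurable
    show "AE s in lborel. integrable lborel (\<lambda>\<eta>. ?f (s, \<eta>))"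
    proof (rule AE_I2)
      fix s :: real
      have "integrable lborel (\<lambda>\<eta>. (indicator {0..1} s * P s) * (indicator {0..1} \<eta> *\<^sub>R (m \<eta> * kern \<eta> (c s))))"
        using kern_integrable(1)[OF c_circ[of s]] unfolding set_integrable_def
        by (rule integrable_mult_right)
      then show "integrable lborel (\<lambda>\<eta>. ?f (s, \<eta>))" by (simp add: mult_ac)
    qed
    show "integrable lborel (\<lambda>s. LINT \<eta>|lborel. norm (?f (s, \<eta>)))"
    proof (rule Bochner_Integration.integrable_bound)
      show "integrable lborel (\<lambda>s::real. indicator {0..1} s * (B * (16 * m 1)) :: real)"
        by (intro integrable_mult_left integrable_real_indicator) auto
      show "(\<lambda>s. LINT \<eta>|lborel. norm (?f (s, \<eta>))) \<in> borel_measurable lborel"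
        by measurable
      show "AE s in lborel. norm (LINT \<eta>|lborel. norm (?f (s, \<eta>))) \<le> norm (indicator {0..1} s * (B * (16 * m 1)))"
      proof (rule AE_I2)
        fix s :: real
        show "norm (LINT \<eta>|lborel. norm (?f (s, \<eta>))) \<le> norm (indicator {0..1} s * (B * (16 * m 1)))"
        proof (cases "s \<in> {0..1}")
          case True
          have "(LINT \<eta>|lborel. norm (?f (s, \<eta>))) = (LINT \<eta>:{0..1}|lborel. \<bar>P s\<bar> * \<bar>m \<eta> * kern \<eta> (c s)\<bar>)"
            using True by (simp add: set_lebesgue_integral_def abs_mult mult_ac)
          also have "\<dots> = \<bar>P s\<bar> * (LINT \<eta>:{0..1}|lborel. \<bar>m \<eta> * kern \<eta> (c s)\<bar>)" by simp
          finally have eq: "(LINT \<eta>|lborel. norm (?f (s, \<eta>))) = \<bar>P s\<bar> * (LINT \<eta>:{0..1}|lborel. \<bar>m \<eta> * kern \<eta> (c s)\<bar>)" .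
          have nn: "0 \<le> (LINT \<eta>:{0..1}|lborel. \<bar>m \<eta> * kern \<eta> (c s)\<bar>)"
            unfolding set_lebesgue_integral_def by (intro integral_nonneg_AE) auto
          have B0: "B \<ge> 0" using B[OF True] by linarith
          have "\<bar>P s\<bar> * (LINT \<eta>:{0..1}|lborel. \<bar>m \<eta> * kern \<eta> (c s)\<bar>) \<le> B * (16 * m 1)"
            using B[OF True] kern_integrable(2)[OF c_circ[of s]] nn B0 by (intro mult_mono) auto
          then show ?thesis unfolding eq using True nn B0 m_nonneg[of 1] by simp
        qed simp
      qed
    qed
  qed
  also have "\<dots> = (LINT \<eta>:{0..1}|lborel. m \<eta> * J \<eta>)"
    unfolding set_lebesgue_integral_def
  proof (rule Bochner_Integration.integral_cong[OF refl])
    fix \<eta> :: real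
    show "(LINT s|lborel. indicator {0..1} s * (indicator {0..1} \<eta> * (m \<eta> * kern \<eta> (c s) * P s)))
      = indicator {0..1} \<eta> *\<^sub>R (m \<eta> * J \<eta>)"
    proof (cases "0 < \<eta> \<and> \<eta> \<le> 1")
      case True
      have "continuous_on {0..1} (\<lambda>s. kern \<eta> (c s) * P s)"
      proof -
        have "(of_real \<eta>)\<^sup>2 - (c s)\<^sup>2 \<noteq> 0" for s
        proof -
          have "(\<eta>^2 + (cmod (c s))^2) / 2 > 0" using True by (simp add: add_pos_nonneg)
          also have "\<dots> \<le> cmod ((of_real \<eta>)\<^sup>2 - (c s)\<^sup>2)"
            using True by (intro denominator_lower_bound c_circ) auto
          finally show ?thesis by auto
        qed
        then show ?thesis unfolding kern_def by (intro continuous_intros c_cont P_cont) auto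
      qed
      then have "(LINT s:{0..1}|lborel. kern \<eta> (c s) * P s) = integral {0..1} (\<lambda>s. kern \<eta> (c s) * P s)"
        by (intro set_borel_integral_eq_integral borel_integrable_atLeastAtMost')
      also have "\<dots> = J \<eta>"
        using J[of \<eta>] True by (simp add: c_def P_def integral_unique)
      finally have "(LINT s|lborel. m \<eta> * (indicator {0..1} s * (kern \<eta> (c s) * P s))) = m \<eta> * J \<eta>"
        by (simp add: set_lebesgue_integral_def)
      then show ?thesis using True by (simp add: mult_ac)
    next
      case False
      \<comment> \<open>The hypothesis says nothing about \<open>J 0\<close>, but
        \<open>m 0 = 0\<close> removes that point.\<close>
      then have "\<eta> = 0 \<or> \<eta> \<notin> {0..1}" by auto
      then show ?thesis by (auto simp: m_zero)
    qed
  qed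
  finally show ?thesis .
qed

end

section \<open>Estimates for moduli of continuity and for the angular integrals\<close>

lemma mod_cont_ge:
  assumes "s \<in> E" "t \<in> E" "cmod (s - t) \<le> \<epsilon>"
  shows "ennreal (norm (f s - f t)) \<le> mod_cont E f \<epsilon>"
  unfolding mod_cont_def by (rule SUP_upper2[of "(s, t)"]) (use assms in auto)

lemma mod_cont_mono: "\<epsilon> \<le> \<epsilon>' \<Longrightarrow> mod_cont E f \<epsilon> \<le> mod_cont E f \<epsilon>'"
  unfolding mod_cont_def by (rule SUP_subset_mono) auto

lemma mod_cont_le:
  assumes "\<And>s t. s \<in> E \<Longrightarrow> t \<in> E \<Longrightarrow> cmod (s - t) \<le> \<epsilon> \<Longrightarrow> norm (f s - f t) \<le> B"
  shows "mod_cont E f \<epsilon> \<le> ennreal B"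
  unfolding mod_cont_def by (rule SUP_least) (auto intro!: ennreal_leI assms)

lemma mod_cont_cont_ext_ge:
  assumes "s \<in> D" "t \<in> D" "cmod (s - t) \<le> \<epsilon>"
  shows "ennreal (norm (f s - f t)) \<le> mod_cont (closure D) (cont_ext D f) \<epsilon>"
  using mod_cont_ge[of s "closure D" t \<epsilon> "cont_ext D f"] assms closure_subset[of D]
  by (auto simp: cont_ext_def)

text \<open>With \<open>p = Re (z * cnj a)\<close>, the real part of \<open>z * cnj (z - a)\<close>
  is \<open>1 - p\<close>, and the squared distance of \<open>z\<close> and \<open>a\<close> is
  \<open>2 - 2 * p\<close>.\<close>

lemma Re_unit_divide_diff:
  assumes "cmod z = 1" "cmod a = 1" "z \<noteq> a"
  shows "Re (z / (z - a)) = 1 / 2"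
proof -
  define p where "p = Re (z * cnj a)"
  have z: "(Re z)^2 + (Im z)^2 = 1" "(Re a)^2 + (Im a)^2 = 1"
    using assms(1,2) cmod_power2[of z] cmod_power2[of a] by auto
  have n: "(cmod (z - a))^2 = 2 - 2 * p"
    unfolding cmod_power2 using z by (simp add: p_def power2_diff)
  have "Re (z * cnj (z - a)) = 1 - p"
    using z by (simp add: p_def algebra_simps power2_eq_square)
  then have "Re (z / (z - a)) = (1 - p) / (2 - 2 * p)"
    by (subst complex_div_cnj) (simp add: n Re_divide_of_real del: of_real_power of_real_diff flip: of_real_power)
  moreover have "2 - 2 * p \<noteq> 0" using n assms(3) by auto
  then have "(1 - p) / (2 - 2 * p) = 1 / 2" by (simp add: field_simps)
  ultimately show ?thesis by (rule trans)
qed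

text \<open>By the inscribed angle theorem, \<open>d arg (t - \<xi>)\<close> is half the arc length element.\<close>

lemma M_circ_le: "M_circ g \<epsilon> \<le> ennreal pi * mod_cont circ g \<epsilon>"
proof (cases "mod_cont circ g \<epsilon>")
  case top
  then show ?thesis by (simp add: ennreal_mult_top)
next
  case (real B)
  have B: "\<bar>g s - g t\<bar> \<le> B" if "s \<in> circ" "t \<in> circ" "cmod (s - t) \<le> \<epsilon>" for s t
    using mod_cont_ge[of s circ t \<epsilon> g, OF that] real by simp
  define c where "c = circlepath (-1) 1"
  have c_circ: "c s \<in> circ" for s
    by (simp add: c_def circlepath circ_def norm_exp_eq_Re)
  have "\<bar>arg_integral \<xi> (circ_arc \<xi> \<epsilon> - circ_arc \<xi> \<delta>) (\<lambda>t. g t - g \<xi>)\<bar> \<le> pi * B"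
    if \<xi>: "\<xi> \<in> circ" and \<delta>: "0 < \<delta>" "\<delta> < \<epsilon>" for \<xi> \<delta>
  proof -
    define S where "S = {s \<in> {0..1}. c s \<in> circ_arc \<xi> \<epsilon> - circ_arc \<xi> \<delta>}"
    define F where "F s = (g (c s) - g \<xi>) * Re (1 / \<i> * (vector_derivative c (at s) / (c s - \<xi>)))" for s
    have F: "\<bar>F s\<bar> \<le> pi * B" if s: "s \<in> S" for s
    proof -
      have "c s \<noteq> \<xi>" using s \<delta> \<xi> by (auto simp: S_def circ_arc_def)
      then have "Re ((c s + 1) / ((c s + 1) - (\<xi> + 1))) = 1 / 2"
        using c_circ[of s] \<xi> by (intro Re_unit_divide_diff) (auto simp: circ_def)
      moreover have "1 / \<i> * (vector_derivative c (at s) / (c s - \<xi>))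
          = of_real (2 * pi) * ((c s + 1) / ((c s + 1) - (\<xi> + 1)))"
        unfolding c_def vector_derivative_circlepath by (simp add: circlepath mult_ac)
      ultimately have "Re (1 / \<i> * (vector_derivative c (at s) / (c s - \<xi>))) = pi"
        by (simp only: times_complex.sel) simp
      moreover have "\<bar>g (c s) - g \<xi>\<bar> \<le> B" using s \<xi> by (intro B) (auto simp: S_def circ_arc_def)
      ultimately show ?thesis by (simp add: F_def abs_mult)
    qed
    have "\<bar>integral S F\<bar> \<le> pi * B"
    proof (cases "F integrable_on S")
      case True
      have S: "S \<subseteq> {0..1}" by (auto simp: S_def)
      \<comment> \<open>Extending by 0 to the whole parameter interval, of length 1, loses nothing
        in the bound.\<close>
      have "norm (integral {0..1} (\<lambda>s. if s \<in> S then F s else 0)) \<le> integral {0..1} (\<lambda>s::real. pi * B)"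
        using True F real(1) S by (intro integral_norm_bound_integral) (auto simp: integrable_restrict_Int Int_absorb2)
      then show ?thesis using S by (simp add: integral_restrict_Int Int_absorb2)
    next
      case False
      \<comment> \<open>Without integrability the integral is 0 by convention.\<close>
      then show ?thesis using real(1) by (simp add: not_integrable_integral)
    qed
    then show ?thesis unfolding arg_integral_def S_def F_def[abs_def] c_def .
  qed
  then have "M_circ g \<epsilon> \<le> ennreal (pi * B)"
    unfolding M_circ_def by (intro SUP_least ennreal_leI) auto
  then show ?thesis using real by (simp add: ennreal_mult)
qed

text \<open>Restrict the integral to \<open>[\<epsilon>, 2\<epsilon>]\<close>: there the modulus is
  at least its value at \<open>\<epsilon>\<close>, and
  \<open>1 / \<eta>^2 \<ge> 1 / (4 * \<epsilon>^2)\<close>. The interval has length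
  \<open>\<epsilon>\<close>, which leaves the factor 4.\<close>

lemma mod_cont_le_integral:
  assumes \<epsilon>: "0 < \<epsilon>" "\<epsilon> \<le> 1"
  shows "mod_cont E f \<epsilon> \<le> ennreal 4 * (ennreal \<epsilon> * (\<integral>\<^sup>+\<eta>\<in>{\<epsilon>..4}. mod_cont E f \<eta> / ennreal (\<eta>^2) \<partial>lborel))"
proof -
  define W where "W = mod_cont E f \<epsilon>"
  have "(\<integral>\<^sup>+\<eta>. (W * ennreal (1 / (4 * \<epsilon>^2))) * indicator {\<epsilon>..2*\<epsilon>} \<eta> \<partial>lborel)
      \<le> (\<integral>\<^sup>+\<eta>\<in>{\<epsilon>..4}. mod_cont E f \<eta> / ennreal (\<eta>^2) \<partial>lborel)"
  proof (rule nn_integral_mono)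
    fix \<eta> :: real
    show "(W * ennreal (1 / (4 * \<epsilon>^2))) * indicator {\<epsilon>..2*\<epsilon>} \<eta> \<le> mod_cont E f \<eta> / ennreal (\<eta>^2) * indicator {\<epsilon>..4} \<eta>"
    proof (cases "\<eta> \<in> {\<epsilon>..2*\<epsilon>}")
      case True
      have "\<eta>^2 \<le> (2 * \<epsilon>)^2" using True \<epsilon> by (intro power_mono) auto
      then have "1 / (4 * \<epsilon>^2) \<le> 1 / \<eta>^2" using True \<epsilon> by (intro divide_left_mono) (auto simp: power_mult_distrib)
      then have "W * ennreal (1 / (4 * \<epsilon>^2)) \<le> mod_cont E f \<eta> * ennreal (1 / \<eta>^2)"
        using True unfolding W_def by (intro mult_mono mod_cont_mono ennreal_leI) auto
      also have "\<dots> = mod_cont E f \<eta> / ennreal (\<eta>^2)"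
        using True \<epsilon> by (simp add: divide_ennreal_def inverse_ennreal inverse_eq_divide)
      finally show ?thesis using True \<epsilon> by simp
    qed simp
  qed
  also have "(\<integral>\<^sup>+\<eta>. (W * ennreal (1 / (4 * \<epsilon>^2))) * indicator {\<epsilon>..2*\<epsilon>} \<eta> \<partial>lborel) = W * ennreal (1 / (4 * \<epsilon>^2)) * ennreal \<epsilon>"
    using \<epsilon> by (subst nn_integral_cmult_indicator) auto
  finally have "ennreal 4 * (ennreal \<epsilon> * (W * ennreal (1 / (4 * \<epsilon>^2)) * ennreal \<epsilon>))
      \<le> ennreal 4 * (ennreal \<epsilon> * (\<integral>\<^sup>+\<eta>\<in>{\<epsilon>..4}. mod_cont E f \<eta> / ennreal (\<eta>^2) \<partial>lborel))"
    by (intro mult_left_mono) auto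
  moreover have "ennreal 4 * (ennreal \<epsilon> * (W * ennreal (1 / (4 * \<epsilon>^2)) * ennreal \<epsilon>))
      = W * ennreal (4 * \<epsilon> * (1 / (4 * \<epsilon>^2)) * \<epsilon>)"
  proof -
    have "ennreal (4 * \<epsilon> * q * \<epsilon>) = ennreal 4 * ennreal \<epsilon> * ennreal q * ennreal \<epsilon>" if "0 \<le> q" for q
      using that \<epsilon> by (simp add: ennreal_mult)
    from this[of "1 / (4 * \<epsilon>^2)"] show ?thesis by (simp add: mult_ac)
  qed
  moreover have "4 * \<epsilon> * (1 / (4 * \<epsilon>^2)) * \<epsilon> = 1" using \<epsilon> by (simp add: power2_eq_square)
  ultimately show ?thesis by (simp add: W_def)
qed

section \<open>The potential on the real axis\<close>

definition axis_kern :: "real \<Rightarrow> real \<Rightarrow> real" where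
  "axis_kern \<eta> x = x / (\<eta> + x)^2 + x * (1 - x) / (x * (1 - \<eta>) + \<eta>)^2"

text \<open>The sign is taken out so that both summands of \<open>axis_kern\<close> are nonnegative
  for \<open>0 < x \<le> 1\<close>; lower bounds may then drop one of them.\<close>

lemma hol_kern_axis: "hol_kern \<eta> (of_real (- x)) = of_real (- axis_kern \<eta> x / 4)"
proof -
  have "(- x - \<eta>)^2 = (\<eta> + x)^2" "((1 - \<eta>) * (- x) - \<eta>)^2 = (x * (1 - \<eta>) + \<eta>)^2"
    by (simp_all add: power2_eq_square algebra_simps)
  moreover have "- x * (- x + 1) = - (x * (1 - x))" by (simp add: algebra_simps)
  ultimately have "- axis_kern \<eta> x / 4 = (- x / (- x - \<eta>)^2 + - x * (- x + 1) / ((1 - \<eta>) * (- x) - \<eta>)^2) / 4"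
    by (simp only: axis_kern_def) simp
  then show ?thesis unfolding hol_kern_def by simp
qed

lemma axis_kern_denominator:
  fixes x \<eta> :: real
  assumes "0 < x" "0 \<le> \<eta>" "\<eta> \<le> 1"
  shows "0 < x * (1 - \<eta>) + \<eta>"
  using assms by (cases "\<eta> = 1") (auto intro: add_pos_nonneg)

lemma axis_kern_continuous: "0 < x \<Longrightarrow> continuous_on {0..1} (\<lambda>\<eta>. axis_kern \<eta> x)"
  unfolding axis_kern_def using axis_kern_denominator[of x]
  by (intro continuous_intros) (force+)

lemma axis_kern_lower:
  assumes "0 < x" "x \<le> 1"
  shows "x / (\<eta> + x)^2 \<le> axis_kern \<eta> x"
  using assms by (simp add: axis_kern_def)

text \<open>For \<open>x \<le> 1 / 2\<close> the second denominator is at least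
  \<open>((\<eta> + x) / 2)^2\<close>, so the second summand is at most four times the
  first.\<close>

lemma axis_kern_upper:
  assumes "0 < x" "x \<le> 1 / 2" "0 \<le> \<eta>" "\<eta> \<le> 1"
  shows "axis_kern \<eta> x \<le> 5 * (x / (\<eta> + x)^2)"
proof -
  have "x * \<eta> \<le> 1 / 2 * \<eta>" using assms by (intro mult_right_mono) auto
  then have "(\<eta> + x) / 2 \<le> x - x * \<eta> + \<eta>" using assms by simp
  also have "\<dots> = x * (1 - \<eta>) + \<eta>" by (simp add: algebra_simps)
  finally have "(\<eta> + x) / 2 \<le> x * (1 - \<eta>) + \<eta>" .
  then have "((\<eta> + x) / 2)^2 \<le> (x * (1 - \<eta>) + \<eta>)^2" using assms by (intro power_mono) auto
  then have "x * (1 - x) / (x * (1 - \<eta>) + \<eta>)^2 \<le> x * 1 / ((\<eta> + x) / 2)^2"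
    using assms by (intro frac_le mult_mono) auto
  then show ?thesis by (simp add: axis_kern_def power_divide)
qed

context majorant
begin

definition axis_pot :: "real \<Rightarrow> real" where
  "axis_pot x = (LINT \<eta>:{0..1}|lborel. m \<eta> * axis_kern \<eta> x)"

lemma axis_kern_integrable:
  "0 < x \<Longrightarrow> set_integrable lborel {0..1} (\<lambda>\<eta>. m \<eta> * axis_kern \<eta> x)"
  by (intro set_integrable_m_mult axis_kern_continuous)

lemma dilation_integrable:
  "0 < x \<Longrightarrow> set_integrable lborel {0..1} (\<lambda>\<eta>. m \<eta> * (x / (\<eta> + x)^2))"
  by (intro set_integrable_m_mult continuous_intros) auto

text \<open>The Poisson average is taken at \<open>w = 1 - x\<close>; the centre \<open>-1\<close>
  yields \<open>axis_pot 1\<close>. The factor 8 cancels the half of the average and the quarter in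
  \<open>hol_kern\<close>.\<close>

lemma Re_cauchy_inside:
  assumes g: "\<And>t. t \<in> circ \<Longrightarrow> g t = pot t" and x: "0 < x" "x < 1"
  shows "Re (cauchy_type_integral g (of_real (- x))) = - axis_pot 1 - axis_pot x"
proof -
  have "Re (cauchy_type_integral g (of_real ((1 - x) - 1)))
      = 8 * (LINT \<eta>:{0..1}|lborel. m \<eta> * (Re (hol_kern \<eta> (-1) + hol_kern \<eta> (of_real ((1 - x) - 1))) / 2))"
  proof (rule Re_cauchy_type_integral_pot[OF _ g])
    show "\<bar>1 - x\<bar> \<noteq> 1" using x by auto
    fix \<eta> :: real assume \<eta>: "0 < \<eta>" "\<eta> \<le> 1"
    have "circlepath (-1) 1 s \<in> circ" for s by (simp add: circlepath circ_def norm_exp_eq_Re)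
    then have k: "kern \<eta> (circlepath (-1) 1 s) = Re (hol_kern \<eta> (circlepath (-1) 1 s))" for s
      using kern_eq_Re_hol_kern \<eta> by blast
    show "((\<lambda>s. kern \<eta> (circlepath (-1) 1 s) * Re ((circlepath (-1) 1 s + 1) / (circlepath (-1) 1 s + 1 - of_real (1 - x))))
        has_integral Re (hol_kern \<eta> (-1) + hol_kern \<eta> (of_real ((1 - x) - 1))) / 2) {0..1}"
      unfolding k using x by (intro Poisson_average_inside hol_kern_holomorphic \<eta>) auto
  qed
  also have "(\<lambda>\<eta>. m \<eta> * (Re (hol_kern \<eta> (-1) + hol_kern \<eta> (of_real ((1 - x) - 1))) / 2))
      = (\<lambda>\<eta>. - (1 / 8) * (m \<eta> * axis_kern \<eta> 1 + m \<eta> * axis_kern \<eta> x))"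
    using hol_kern_axis[of _ 1] hol_kern_axis[of _ x] by (simp add: algebra_simps diff_divide_distrib)
  also have "8 * (LINT \<eta>:{0..1}|lborel. - (1 / 8) * (m \<eta> * axis_kern \<eta> 1 + m \<eta> * axis_kern \<eta> x))
      = - (axis_pot 1 + axis_pot x)"
    unfolding set_integral_mult_right axis_pot_def
    by (subst set_integral_add(2)[OF axis_kern_integrable axis_kern_integrable]) (use x in \<open>auto simp: add_divide_distrib\<close>)
  finally show ?thesis by simp
qed

text \<open>Reflection in the circle sends \<open>x\<close> to \<open>- x / (1 + x)\<close>. The
  constant \<open>axis_pot 1\<close> drops out of every increment.\<close>

lemma Re_cauchy_outside:
  assumes g: "\<And>t. t \<in> circ \<Longrightarrow> g t = pot t" and x: "0 < x"
  shows "Re (cauchy_type_integral g (of_real x)) = - axis_pot 1 + axis_pot (x / (1 + x))"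
proof -
  define y where "y = x / (1 + x)"
  have y: "1 / (1 + x) - 1 = - y" "0 < y" using x by (auto simp: y_def field_simps)
  have "Re (cauchy_type_integral g (of_real ((1 + x) - 1)))
      = 8 * (LINT \<eta>:{0..1}|lborel. m \<eta> * (Re (hol_kern \<eta> (-1) - hol_kern \<eta> (of_real (1 / (1 + x) - 1))) / 2))"
  proof (rule Re_cauchy_type_integral_pot[OF _ g])
    show "\<bar>1 + x\<bar> \<noteq> 1" using x by auto
    fix \<eta> :: real assume \<eta>: "0 < \<eta>" "\<eta> \<le> 1"
    have "circlepath (-1) 1 s \<in> circ" for s by (simp add: circlepath circ_def norm_exp_eq_Re)
    then have k: "kern \<eta> (circlepath (-1) 1 s) = Re (hol_kern \<eta> (circlepath (-1) 1 s))" for s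
      using kern_eq_Re_hol_kern \<eta> by blast
    show "((\<lambda>s. kern \<eta> (circlepath (-1) 1 s) * Re ((circlepath (-1) 1 s + 1) / (circlepath (-1) 1 s + 1 - of_real (1 + x))))
        has_integral Re (hol_kern \<eta> (-1) - hol_kern \<eta> (of_real (1 / (1 + x) - 1))) / 2) {0..1}"
      unfolding k using x by (intro Poisson_average_outside hol_kern_holomorphic \<eta>) auto
  qed
  also have "(\<lambda>\<eta>. m \<eta> * (Re (hol_kern \<eta> (-1) - hol_kern \<eta> (of_real (1 / (1 + x) - 1))) / 2))
      = (\<lambda>\<eta>. - (1 / 8) * (m \<eta> * axis_kern \<eta> 1 - m \<eta> * axis_kern \<eta> y))"
    unfolding y(1) using hol_kern_axis[of _ 1] hol_kern_axis[of _ y] by (simp add: algebra_simps diff_divide_distrib)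
  also have "8 * (LINT \<eta>:{0..1}|lborel. - (1 / 8) * (m \<eta> * axis_kern \<eta> 1 - m \<eta> * axis_kern \<eta> y))
      = - (axis_pot 1 - axis_pot y)"
    unfolding set_integral_mult_right axis_pot_def
    by (subst set_integral_diff(2)[OF axis_kern_integrable axis_kern_integrable]) (use y in \<open>auto simp: diff_divide_distrib\<close>)
  finally show ?thesis by (simp add: y_def)
qed

text \<open>Split the integral at \<open>\<tau>\<close>: below it \<open>m\<close> is small and the
  kernel has integral at most 1, above it the kernel is at most \<open>x / \<tau>^2\<close>.\<close>

lemma axis_pot_small:
  assumes "0 < e" "0 < a"
  obtains x where "0 < x" "x < a" "x < 1 / 2" "axis_pot x < e"
proof -
  have "\<forall>\<^sub>F \<tau> in at_right 0. m \<tau> < e / 10"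
    using m_tendsto assms by (intro order_tendstoD) auto
  then have "\<forall>\<^sub>F \<tau> in at_right 0. m \<tau> < e / 10 \<and> 0 < \<tau>"
    by (intro eventually_conj eventually_at_right_less)
  then obtain \<tau> where \<tau>: "m \<tau> < e / 10" "0 < \<tau>"
    using eventually_happens'[OF trivial_limit_at_right_real] by blast
  \<comment> \<open>The last entry makes the part above \<open>\<tau>\<close> at most
    \<open>e / 2\<close>, after the factor 5 from \<open>axis_kern_upper\<close>; the
    \<open>+ 1\<close> excludes a zero denominator. The part below \<open>\<tau>\<close> is less
    than \<open>5 * (e / 10)\<close>.\<close>
  define x where "x = min (min (a / 2) (1 / 4)) (e * \<tau>^2 / (10 * (m 1 + 1)))"
  have m1: "m 1 + 1 > 0" using m_nonneg[of 1] by simp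
  have x: "0 < x" "x < a" "x < 1 / 2" using assms \<tau> m1 by (auto simp: x_def)
  have "x \<le> e * \<tau>^2 / (10 * (m 1 + 1))" by (simp add: x_def)
  then have "10 * ((m 1 + 1) * x) \<le> e * \<tau>^2" using m1 by (simp add: field_simps)
  then have "10 * (m 1 * x) \<le> e * \<tau>^2" using x by (simp add: algebra_simps)
  then have small: "5 * (m 1 * x / \<tau>^2) \<le> e / 2" using \<tau> by (simp add: field_simps)
  have K: "set_integrable lborel {0..1} (\<lambda>\<eta>. m \<tau> * (x / (\<eta> + x)^2))"
    by (intro set_integrable_mult_right set_integral_dilation_kernel(1) x(1))
  have c: "set_integrable lborel {0..1} (\<lambda>\<eta>::real. m 1 * x / \<tau>^2)"
    by (intro borel_integrable_atLeastAtMost' continuous_intros)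
  have i: "set_integrable lborel {0..1} (\<lambda>\<eta>. 5 * (m \<tau> * (x / (\<eta> + x)^2) + m 1 * x / \<tau>^2))"
    using set_integral_add(1)[OF K c] by (rule set_integrable_mult_right)
  have "axis_pot x \<le> (LINT \<eta>:{0..1}|lborel. 5 * (m \<tau> * (x / (\<eta> + x)^2) + m 1 * x / \<tau>^2))"
    unfolding axis_pot_def
  proof (rule set_integral_mono[OF axis_kern_integrable[OF x(1)] i])
    fix \<eta> :: real assume \<eta>: "\<eta> \<in> {0..1}"
    have "m \<eta> * axis_kern \<eta> x \<le> m \<eta> * (5 * (x / (\<eta> + x)^2))"
      using \<eta> x by (intro mult_left_mono axis_kern_upper m_nonneg) auto
    then have "m \<eta> * axis_kern \<eta> x \<le> 5 * (m \<eta> * (x / (\<eta> + x)^2))"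
      by (simp only: mult.left_commute[of _ 5])
    moreover have "m \<eta> * (x / (\<eta> + x)^2) \<le> m \<tau> * (x / (\<eta> + x)^2) + m 1 * x / \<tau>^2"
    proof (cases "\<eta> \<le> \<tau>")
      case True
      have "m \<eta> * (x / (\<eta> + x)^2) \<le> m \<tau> * (x / (\<eta> + x)^2)"
        using x True by (intro mult_right_mono monoD[OF m_mono]) auto
      moreover have "0 \<le> m 1 * x / \<tau>^2" using x m_nonneg by simp
      ultimately show ?thesis by linarith
    next
      case False
      have "\<tau>^2 \<le> (\<eta> + x)^2" using False x \<tau> by (intro power_mono) auto
      then have "x / (\<eta> + x)^2 \<le> x / \<tau>^2" using x \<tau> False by (intro divide_left_mono) auto
      then have "m \<eta> * (x / (\<eta> + x)^2) \<le> m 1 * (x / \<tau>^2)"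
        using \<eta> x m_le_one[of \<eta>] m_nonneg by (intro mult_mono) auto
      moreover have "0 \<le> m \<tau> * (x / (\<eta> + x)^2)" using x m_nonneg by simp
      ultimately show ?thesis by simp
    qed
    then have "5 * (m \<eta> * (x / (\<eta> + x)^2)) \<le> 5 * (m \<tau> * (x / (\<eta> + x)^2) + m 1 * x / \<tau>^2)"
      by (rule mult_left_mono) simp
    ultimately show "m \<eta> * axis_kern \<eta> x \<le> 5 * (m \<tau> * (x / (\<eta> + x)^2) + m 1 * x / \<tau>^2)"
      by (rule order_trans)
  qed
  also have "\<dots> = 5 * (m \<tau> * (LINT \<eta>:{0..1}|lborel. x / (\<eta> + x)^2) + m 1 * x / \<tau>^2)"
    unfolding set_integral_mult_right set_integral_add(2)[OF K c] by (simp add: set_integral_const)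
  also have "\<dots> \<le> 5 * (m \<tau> * 1 + m 1 * x / \<tau>^2)"
    using set_integral_dilation_kernel(2)[OF x(1)] m_nonneg by (intro mult_left_mono add_right_mono) auto
  also have "\<dots> < e" using small \<tau>(1) by simp
  finally show ?thesis using x that by blast
qed

text \<open>The substitution \<open>\<eta> \<mapsto> \<eta>/4\<close> reaches the interval up to \<open>4\<close> from the potential over \<open>[0, 1]\<close>.\<close>

lemma axis_pot_lower:
  assumes \<epsilon>: "0 < \<epsilon>" "\<epsilon> \<le> 1" and x: "\<epsilon> / 2 \<le> x" "x \<le> \<epsilon>"
  shows "ennreal (\<epsilon> / (50 * \<sigma>)) * (\<integral>\<^sup>+\<eta>\<in>{\<epsilon>..4}. ennreal (m \<eta> / \<eta>^2) \<partial>lborel) \<le> ennreal (axis_pot x)"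
proof -
  have x0: "0 < x" "x \<le> 1" using \<epsilon> x by auto
  define f where "f \<eta> = ennreal (indicator {0..1} \<eta> * (m \<eta> * (x / (\<eta> + x)^2)))" for \<eta>
  have [measurable]: "f \<in> borel_measurable borel" unfolding f_def by measurable
  have "(\<integral>\<^sup>+\<eta>\<in>{\<epsilon>..4}. ennreal (\<epsilon> * (2 / (25 * \<sigma>))) * ennreal (m \<eta> / \<eta>^2) \<partial>lborel) \<le> (\<integral>\<^sup>+\<eta>. f (0 + 1 / 4 * \<eta>) \<partial>lborel)"
  proof (rule nn_integral_mono)
    fix \<eta> :: real
    show "ennreal (\<epsilon> * (2 / (25 * \<sigma>))) * ennreal (m \<eta> / \<eta>^2) * indicator {\<epsilon>..4} \<eta> \<le> f (0 + 1 / 4 * \<eta>)"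
    proof (cases "\<eta> \<in> {\<epsilon>..4}")
      case True
      then have \<eta>: "0 < \<eta>" "\<epsilon> \<le> \<eta>" "\<eta> \<le> 4" using \<epsilon> by auto
      have "m \<eta> \<le> \<sigma> * 4 * m (\<eta> / 4)" using m_scale[of 4 "\<eta> / 4"] \<eta> by simp
      then have 1: "m \<eta> / (4 * \<sigma>) \<le> m (\<eta> / 4)" using \<sigma> by (simp add: field_simps)
      have "(\<eta> / 4 + x)^2 \<le> (5 / 4 * \<eta>)^2" using \<eta> x x0 by (intro power_mono) auto
      then have 2: "(\<epsilon> / 2) / (5 / 4 * \<eta>)^2 \<le> x / (\<eta> / 4 + x)^2"
        using \<eta> x x0 by (intro frac_le) auto
      \<comment> \<open>The constant collects \<open>1 / (4 * \<sigma>)\<close> from the growth of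
        \<open>m\<close>, \<open>1 / 2\<close> from \<open>x \<ge> \<epsilon> / 2\<close>, and
        \<open>16 / 25\<close> from \<open>\<eta> / 4 + x \<le> 5 / 4 * \<eta>\<close>. The Jacobian
        \<open>1 / 4\<close> later turns it into \<open>1 / (50 * \<sigma>)\<close>.\<close>
      have "\<epsilon> * (2 / (25 * \<sigma>)) * (m \<eta> / \<eta>^2) = m \<eta> / (4 * \<sigma>) * ((\<epsilon> / 2) / (5 / 4 * \<eta>)^2)"
        using \<sigma> \<eta> by (simp add: field_simps power2_eq_square)
      also have "\<dots> \<le> m (\<eta> / 4) * (x / (\<eta> / 4 + x)^2)"
        using 1 2 \<epsilon> \<sigma> m_nonneg by (intro mult_mono) auto
      finally show ?thesis
        using True \<eta> \<epsilon> \<sigma> m_nonneg by (simp add: f_def ennreal_mult[symmetric] ennreal_leI)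
    qed simp
  qed
  then have "ennreal (1 / 4) * (ennreal (\<epsilon> * (2 / (25 * \<sigma>))) * (\<integral>\<^sup>+\<eta>\<in>{\<epsilon>..4}. ennreal (m \<eta> / \<eta>^2) \<partial>lborel))
      \<le> ennreal (1 / 4) * (\<integral>\<^sup>+\<eta>. f (0 + 1 / 4 * \<eta>) \<partial>lborel)"
    by (intro mult_left_mono) (simp_all add: nn_integral_cmult mult.assoc)
  also have "\<dots> = (\<integral>\<^sup>+\<eta>. f \<eta> \<partial>lborel)"
    using nn_integral_real_affine[of f "1 / 4" 0] by simp
  also have "\<dots> = ennreal (LINT \<eta>:{0..1}|lborel. m \<eta> * (x / (\<eta> + x)^2))"
    unfolding f_def set_lebesgue_integral_def
    using dilation_integrable[OF x0(1)] x0 m_nonneg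
    by (subst nn_integral_eq_integral) (auto simp: set_integrable_def)
  also have "\<dots> \<le> ennreal (axis_pot x)"
    unfolding axis_pot_def using x0
    by (intro ennreal_leI set_integral_mono dilation_integrable axis_kern_integrable mult_left_mono axis_kern_lower m_nonneg) auto
  also have "ennreal (1 / 4) * (ennreal (\<epsilon> * (2 / (25 * \<sigma>))) * (\<integral>\<^sup>+\<eta>\<in>{\<epsilon>..4}. ennreal (m \<eta> / \<eta>^2) \<partial>lborel))
      = ennreal (\<epsilon> / (50 * \<sigma>)) * (\<integral>\<^sup>+\<eta>\<in>{\<epsilon>..4}. ennreal (m \<eta> / \<eta>^2) \<partial>lborel)"
    using \<epsilon> \<sigma> by (simp add: mult.assoc[symmetric] ennreal_mult[symmetric] field_simps)
  finally show ?thesis .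
qed

text \<open>
  The point \<open>0\<close> is replaced by points of \<open>D\<close> tending to it, so the boundary values of the
  continuous extension are not needed.
\<close>

lemma axis_pot_le_mod_cont:
  assumes g: "\<And>t. t \<in> circ \<Longrightarrow> g t = pot t" and D: "D = dom_plus \<or> D = dom_minus" and \<epsilon>: "0 < \<epsilon>" "\<epsilon> < 1"
  obtains x where "\<epsilon> / 2 \<le> x" "x \<le> \<epsilon>"
    "ennreal (axis_pot x) \<le> mod_cont (closure D) (cont_ext D (\<lambda>z. Re (cauchy_type_integral g z))) \<epsilon>"
proof -
  let ?F = "\<lambda>z. Re (cauchy_type_integral g z)"
  have norm_add_one: "cmod (of_real u + 1) = \<bar>u + 1\<bar>" for u
    using norm_of_real[of "u + 1", where 'a = complex] by simp
  define W where "W = mod_cont (closure D) (cont_ext D ?F) \<epsilon>"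
  \<comment> \<open>Outside the circle the point used is \<open>\<epsilon>\<close> itself, whose
    reflection is \<open>- \<epsilon> / (1 + \<epsilon>)\<close>; since
    \<open>\<epsilon> < 1\<close>, its distance from 0 is at least
    \<open>\<epsilon> / 2\<close>.\<close>
  define x where "x = (if D = dom_plus then \<epsilon> else \<epsilon> / (1 + \<epsilon>))"
  have "\<epsilon> * \<epsilon> \<le> \<epsilon> * 1" using \<epsilon> by (intro mult_left_mono) auto
  then have x: "\<epsilon> / 2 \<le> x" "x \<le> \<epsilon>" using \<epsilon> by (auto simp: x_def field_simps)
  have "ennreal (axis_pot x) \<le> W"
  proof (rule ennreal_le_epsilon)
    fix e :: real assume e: "0 < e"
    have "0 < x" using x \<epsilon> by simp
    from axis_pot_small[OF e this] obtain y where y: "0 < y" "y < x" "y < 1 / 2" "axis_pot y < e" .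
    obtain p q where pq: "p \<in> D" "q \<in> D" "cmod (p - q) \<le> \<epsilon>" "axis_pot x - axis_pot y \<le> norm (?F p - ?F q)"
    proof (cases "D = dom_plus")
      case True
      show ?thesis
      proof (rule that)
        show "of_real (- x) \<in> D" "of_real (- y) \<in> D"
          using x y \<epsilon> unfolding True dom_plus_def mem_Collect_eq norm_add_one by auto
        show "cmod (of_real (- x) - of_real (- y)) \<le> \<epsilon>"
          using x y unfolding of_real_diff[symmetric] norm_of_real by auto
        show "axis_pot x - axis_pot y \<le> norm (?F (of_real (- x)) - ?F (of_real (- y)))"
          using Re_cauchy_inside[OF g, of x] Re_cauchy_inside[OF g, of y] x y \<epsilon> by simp
      qed
    next
      case False
      then have D: "D = dom_minus" and x_eq: "x = \<epsilon> / (1 + \<epsilon>)" using D by (auto simp: x_def)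
      \<comment> \<open>This is the point outside the circle whose reflection is
        \<open>- y\<close>.\<close>
      define z where "z = y / (1 - y)"
      have z: "0 < z" "z / (1 + z) = y" using y by (auto simp: z_def field_simps)
      have "z < \<epsilon>"
      proof -
        have "y * (1 + \<epsilon>) < \<epsilon>" using y(2) \<epsilon> unfolding x_eq by (simp add: field_simps)
        then have "y < \<epsilon> * (1 - y)" by (simp add: algebra_simps)
        then show ?thesis unfolding z_def using y by (simp add: divide_less_eq)
      qed
      show ?thesis
      proof (rule that)
        show "of_real \<epsilon> \<in> D" "of_real z \<in> D"
          using z \<epsilon> unfolding D dom_minus_def mem_Collect_eq norm_add_one by auto
        show "cmod (of_real \<epsilon> - of_real z) \<le> \<epsilon>"
          using z \<open>z < \<epsilon>\<close> unfolding of_real_diff[symmetric] norm_of_real by auto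
        show "axis_pot x - axis_pot y \<le> norm (?F (of_real \<epsilon>) - ?F (of_real z))"
          using Re_cauchy_outside[OF g, of \<epsilon>] Re_cauchy_outside[OF g, of z] z \<epsilon> by (simp add: x_eq)
      qed
    qed
    have "axis_pot x \<le> norm (?F p - ?F q) + e" using pq(4) y(4) by linarith
    then have "ennreal (axis_pot x) \<le> ennreal (norm (?F p - ?F q) + e)" by (rule ennreal_leI)
    also have "\<dots> = ennreal (norm (?F p - ?F q)) + ennreal e" using e by (intro ennreal_plus) auto
    also have "\<dots> \<le> W + ennreal e"
      unfolding W_def using mod_cont_cont_ext_ge[OF pq(1-3), of ?F] by (intro add_right_mono)
    finally show "ennreal (axis_pot x) \<le> W + ennreal e" .
  qed
  with x show ?thesis unfolding W_def by (rule that)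
qed

section \<open>The two inequalities\<close>

lemma pot_modulus_bounds:
  assumes g: "\<And>t. t \<in> circ \<Longrightarrow> g t = pot t"
  shows "\<exists>c>0. \<exists>c\<^sub>1>0. \<forall>D \<in> {dom_plus, dom_minus}. \<forall>\<epsilon> \<in> {0<..1/4}.
      mod_cont (closure D) (cont_ext D (\<lambda>z. Re (cauchy_type_integral g z))) \<epsilon>
        \<ge> ennreal c * (ennreal \<epsilon> * (\<integral>\<^sup>+\<eta>\<in>{\<epsilon>..4}. mod_cont circ g \<eta> / ennreal (\<eta>^2) \<partial>lborel)) \<and>
      ennreal c * (ennreal \<epsilon> * (\<integral>\<^sup>+\<eta>\<in>{\<epsilon>..4}. mod_cont circ g \<eta> / ennreal (\<eta>^2) \<partial>lborel))
        \<ge> ennreal c\<^sub>1 * (M_circ g \<epsilon> +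
             ennreal \<epsilon> * (\<integral>\<^sup>+\<eta>\<in>{\<epsilon>..4}. mod_cont circ g \<eta> / ennreal (\<eta>^2) \<partial>lborel))"
proof -
  define C where "C = 4096 * \<sigma>^2"
  have C: "C > 0" using \<sigma> by (simp add: C_def)
  \<comment> \<open>\<open>1 / C\<close> passes from the modulus of \<open>g\<close> to
    \<open>m\<close>, and \<open>1 / (50 * \<sigma>)\<close> is the constant of
    \<open>axis_pot_lower\<close>.\<close>
  define c where "c = 1 / (50 * \<sigma> * C)"
  have c: "c > 0" using \<sigma> C by (simp add: c_def)
  have main: "ennreal c * (ennreal \<epsilon> * I) \<le> mod_cont (closure D) (cont_ext D (\<lambda>z. Re (cauchy_type_integral g z))) \<epsilon> \<and>
      ennreal (c / 17) * (M_circ g \<epsilon> + ennreal \<epsilon> * I) \<le> ennreal c * (ennreal \<epsilon> * I)"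
    if D: "D \<in> {dom_plus, dom_minus}" and \<epsilon>: "\<epsilon> \<in> {0<..1/4}"
      and I: "I = (\<integral>\<^sup>+\<eta>\<in>{\<epsilon>..4}. mod_cont circ g \<eta> / ennreal (\<eta>^2) \<partial>lborel)" for D \<epsilon> I
  proof
    have \<epsilon>': "0 < \<epsilon>" "\<epsilon> \<le> 1" "\<epsilon> < 1" using \<epsilon> by auto
    have "I \<le> (\<integral>\<^sup>+\<eta>\<in>{\<epsilon>..4}. ennreal C * ennreal (m \<eta> / \<eta>^2) \<partial>lborel)"
      unfolding I
    proof (rule nn_integral_mono)
      fix \<eta> :: real
      show "mod_cont circ g \<eta> / ennreal (\<eta>^2) * indicator {\<epsilon>..4} \<eta> \<le> ennreal C * ennreal (m \<eta> / \<eta>^2) * indicator {\<epsilon>..4} \<eta>"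
      proof (cases "\<eta> \<in> {\<epsilon>..4}")
        case True
        then have \<eta>: "0 < \<eta>" using \<epsilon>' by auto
        have "mod_cont circ g \<eta> \<le> ennreal (C * m \<eta>)"
          using pot_diff_bound \<eta> by (intro mod_cont_le) (auto simp: g C_def)
        then have "mod_cont circ g \<eta> / ennreal (\<eta>^2) \<le> ennreal (C * m \<eta>) / ennreal (\<eta>^2)"
          by (rule divide_right_mono_ennreal)
        also have "\<dots> = ennreal (C * m \<eta> / \<eta>^2)"
          using C \<eta> m_nonneg by (intro divide_ennreal) auto
        also have "\<dots> = ennreal C * ennreal (m \<eta> / \<eta>^2)"
          using C m_nonneg by (simp add: ennreal_mult[symmetric])
        finally show ?thesis using True by simp
      qed simp
    qed
    also have "\<dots> = ennreal C * (\<integral>\<^sup>+\<eta>\<in>{\<epsilon>..4}. ennreal (m \<eta> / \<eta>^2) \<partial>lborel)"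
      by (simp add: nn_integral_cmult mult.assoc)
    finally have "ennreal c * (ennreal \<epsilon> * I)
        \<le> ennreal c * (ennreal \<epsilon> * (ennreal C * (\<integral>\<^sup>+\<eta>\<in>{\<epsilon>..4}. ennreal (m \<eta> / \<eta>^2) \<partial>lborel)))"
      by (intro mult_left_mono) auto
    also have "\<dots> = ennreal (\<epsilon> / (50 * \<sigma>)) * (\<integral>\<^sup>+\<eta>\<in>{\<epsilon>..4}. ennreal (m \<eta> / \<eta>^2) \<partial>lborel)"
    proof -
      have "c * \<epsilon> * C = \<epsilon> / (50 * \<sigma>)" using C \<sigma> by (simp add: c_def field_simps)
      then show ?thesis using c C \<epsilon>' by (simp add: mult.assoc[symmetric] ennreal_mult[symmetric])
    qed
    also have "\<dots> \<le> mod_cont (closure D) (cont_ext D (\<lambda>z. Re (cauchy_type_integral g z))) \<epsilon>"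
    proof -
      obtain x where x: "\<epsilon> / 2 \<le> x" "x \<le> \<epsilon>"
        "ennreal (axis_pot x) \<le> mod_cont (closure D) (cont_ext D (\<lambda>z. Re (cauchy_type_integral g z))) \<epsilon>"
        using axis_pot_le_mod_cont[of g D \<epsilon>] g D \<epsilon>' by blast
      show ?thesis using axis_pot_lower[OF \<epsilon>'(1,2) x(1,2)] x(3) by (rule order_trans)
    qed
    finally show "ennreal c * (ennreal \<epsilon> * I) \<le> mod_cont (closure D) (cont_ext D (\<lambda>z. Re (cauchy_type_integral g z))) \<epsilon>" .
    have "M_circ g \<epsilon> \<le> ennreal pi * mod_cont circ g \<epsilon>" by (rule M_circ_le)
    \<comment> \<open>One factor 4 bounds \<open>pi\<close>, the other comes from
      \<open>mod_cont_le_integral\<close>. Together with the integral already present this gives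
      \<open>17 = 4 * 4 + 1\<close>.\<close>
    also have "\<dots> \<le> ennreal 4 * (ennreal 4 * (ennreal \<epsilon> * I))"
      unfolding I using \<epsilon>' pi_less_4 by (intro mult_mono mod_cont_le_integral ennreal_leI) auto
    finally have "M_circ g \<epsilon> + ennreal \<epsilon> * I \<le> ennreal 4 * (ennreal 4 * (ennreal \<epsilon> * I)) + ennreal \<epsilon> * I"
      by (rule add_right_mono)
    also have "\<dots> = ennreal 17 * (ennreal \<epsilon> * I)"
    proof -
      have "ennreal 17 = ennreal 4 * ennreal 4 + 1"
        by simp
      then show ?thesis by (simp only: distrib_right mult_1_left mult.assoc)
    qed
    finally have "ennreal (c / 17) * (M_circ g \<epsilon> + ennreal \<epsilon> * I) \<le> ennreal (c / 17) * (ennreal 17 * (ennreal \<epsilon> * I))"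
      by (intro mult_left_mono) auto
    also have "\<dots> = ennreal c * (ennreal \<epsilon> * I)"
    proof -
      have "ennreal (c / 17) * ennreal 17 = ennreal c" using c by (subst ennreal_mult[symmetric]) auto
      then show ?thesis by (simp only: mult.assoc[symmetric])
    qed
    finally show "ennreal (c / 17) * (M_circ g \<epsilon> + ennreal \<epsilon> * I) \<le> ennreal c * (ennreal \<epsilon> * I)" .
  qed
  show ?thesis
  proof (intro exI conjI ballI)
    show "0 < c" "0 < c / 17" using c by auto
  qed (use main[OF _ _ refl] in blast)+
qed

end

text \<open>Monotonicity and the right limit 0 make \<open>\<mu>\<close> nonnegative on the positive
  axis, so the extension by 0 stays monotone.\<close>

lemma normal_majorant_imp_majorant:
  assumes \<mu>: "normal_majorant \<sigma> 1 \<mu>" and lim: "(\<mu> \<longlongrightarrow> 0) (at_right 0)"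
  shows "majorant (\<lambda>\<eta>. if 0 < \<eta> then \<mu> \<eta> else 0) \<sigma>"
proof
  have mono: "\<mu> x \<le> \<mu> y" if "0 < x" "x \<le> y" for x y
    using \<mu> that by (auto simp: normal_majorant_def mono_on_def)
  have nonneg: "0 \<le> \<mu> x" if "0 < x" for x
  proof (rule tendsto_upperbound[OF lim])
    show "\<forall>\<^sub>F y in at_right 0. \<mu> y \<le> \<mu> x"
      using eventually_at_right_less eventually_at_right_real[OF that]
      by eventually_elim (use mono in auto)
  qed simp
  show "mono (\<lambda>\<eta>. if 0 < \<eta> then \<mu> \<eta> else 0)"
    using mono nonneg by (auto simp: mono_def)
  show \<sigma>: "1 \<le> \<sigma>" using \<mu> by (simp add: normal_majorant_def)
  show "(if 0 < l * x then \<mu> (l * x) else 0) \<le> \<sigma> * l * (if 0 < x then \<mu> x else 0)"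
    if "1 \<le> l" "0 < x" for l x :: real
  proof (cases "l = 1")
    case True
    \<comment> \<open>The growth condition of the class covers only \<open>l > 1\<close>; at
      \<open>l = 1\<close> the claim follows from \<open>\<sigma> \<ge> 1\<close> and
      nonnegativity.\<close>
    have "1 * \<mu> x \<le> \<sigma> * \<mu> x" using \<sigma> nonneg that by (intro mult_right_mono) auto
    then show ?thesis using True that by simp
  next
    case False
    then show ?thesis using \<mu> that by (simp add: normal_majorant_def)
  qed
  have "\<forall>\<^sub>F x in at_right 0. \<mu> x = (if 0 < x then \<mu> x else 0)"
    using eventually_at_right_less[of "0::real"] by eventually_elim simp
  with lim show "((\<lambda>\<eta>. if 0 < \<eta> then \<mu> \<eta> else 0) \<longlongrightarrow> 0) (at_right 0)"
    by (rule Lim_transform_eventually)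
qed simp

theorem corollary1:
  fixes \<sigma> :: real and \<mu> :: "real \<Rightarrow> real" and g :: "complex \<Rightarrow> real"
  assumes "normal_majorant \<sigma> 1 \<mu>"
    and "(\<mu> \<longlongrightarrow> 0) (at_right 0)"
    and "\<And>t. t \<in> circ \<Longrightarrow>
      g t = 8 * integral {0..1} (\<lambda>\<eta>.
        \<mu> \<eta> * ((((Re t)^2 - (Im t)^2) * (\<eta>^4 + cmod t^4) - 2 * \<eta>^2 * cmod t^4)
                / cmod (of_real \<eta>^2 - t^2)^4) * \<eta>)"
  shows "continuous_on circ g \<and>
    (\<exists>c>0. \<exists>c\<^sub>1>0. \<forall>D \<in> {dom_plus, dom_minus}. \<forall>\<epsilon> \<in> {0<..1/4}.
      mod_cont (closure D) (cont_ext D (\<lambda>z. Re (cauchy_type_integral g z))) \<epsilon>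
        \<ge> ennreal c * (ennreal \<epsilon> * (\<integral>\<^sup>+\<eta>\<in>{\<epsilon>..4}. mod_cont circ g \<eta> / ennreal (\<eta>^2) \<partial>lborel)) \<and>
      ennreal c * (ennreal \<epsilon> * (\<integral>\<^sup>+\<eta>\<in>{\<epsilon>..4}. mod_cont circ g \<eta> / ennreal (\<eta>^2) \<partial>lborel))
        \<ge> ennreal c\<^sub>1 * (M_circ g \<epsilon> +
             ennreal \<epsilon> * (\<integral>\<^sup>+\<eta>\<in>{\<epsilon>..4}. mod_cont circ g \<eta> / ennreal (\<eta>^2) \<partial>lborel)))"
proof -
  define m where "m \<eta> = (if 0 < \<eta> then \<mu> \<eta> else 0)" for \<eta>
  interpret majorant m \<sigma>
    using normal_majorant_imp_majorant[OF assms(1,2)] by (simp add: m_def[abs_def])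
  have g: "g t = pot t" if t: "t \<in> circ" for t
  proof -
    have "g t = 8 * integral {0..1} (\<lambda>\<eta>. m \<eta> * kern \<eta> t)"
      unfolding assms(3)[OF t]
    proof (intro arg_cong[of _ _ "\<lambda>x. 8 * x"] integral_cong)
      \<comment> \<open>At \<open>\<eta> = 0\<close> the value of \<open>\<mu>\<close> is arbitrary,
        but the factor \<open>\<eta>\<close> makes both integrands vanish.\<close>
      fix \<eta> :: real assume "\<eta> \<in> {0..1}"
      then show "\<mu> \<eta> * ((((Re t)^2 - (Im t)^2) * (\<eta>^4 + cmod t^4) - 2 * \<eta>^2 * cmod t^4)
                / cmod (of_real \<eta>^2 - t^2)^4) * \<eta> = m \<eta> * kern \<eta> t"
        unfolding kern_formula[symmetric] by (cases "\<eta> = 0") (simp_all add: m_def)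
    qed
    also have "\<dots> = pot t"
      unfolding pot_def set_borel_integral_eq_integral(2)[OF kern_integrable(1)[OF t]] ..
    finally show ?thesis .
  qed
  have "continuous_on circ g"
    using pot_continuous g continuous_on_cong[of circ circ g pot] by blast
  then show ?thesis using pot_modulus_bounds[OF g] by blast
qed

end
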